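(* Let $\sigma$ be a Pisot substitution over the alphabet $\mathcal{A}=\{1,\ldots,d\}$, $d\ge2$. Let $C$ be its contact set, $\hat G_C$ its simple self-replicating contact graph, $G_B$ its self-replicating boundary graph (neighbor graph) and $\hat G_B$ its simple self-replicating boundary graph. Consider the following algorithm with input the contact graph: put $A[1]=\hat G_C$; for $p=2,3,\ldots$ put $A[p]=\mathrm{Red}(C\text{-Corona}(A[p-1]))$; stop at the first $p\ge2$ with $A[p]=A[p-1]$ and output $A[p]$. Then this algorithm terminates after finitely many steps, and its output is the neighbor graph of $\sigma$: $A[p]=\hat G_B$ (equivalently, $G_B$ is the subgraph of the ambient graph $G_{\mathfrak{D}}$ induced by those nodes of the output $A[p]$ that lie in $\mathfrak{D}$).
   Context: Substitutions. $\mathcal{A}^*$ is the free monoid of finite words over $\mathcal{A}=\{1,\dots,d\}$; $\mathbf{l}:\mathcal{A}^*\to\mathbb{N}^d$, $\mathbf{l}(w)=(|w|_i)_{i\in\mathcal{A}}$, counts the occurrences of letters. A substitution $\sigma$ is an endomorphism of $\mathcal{A}^*$ mapping each letter to a nonempty word; its incidence matrix $M$ is defined by $\mathbf{l}(\sigma(i))=M\mathbf{l}(i)$, $i\in\mathcal{A}$. $\sigma$ is a Pisot substitution if the characteristic polynomial of $M$ is the minimal polynomial of a Pisot unit. Let $\mathbf{v}$ be the dominant left eigenvector of $M$ (with positive coordinates), and $\mathbf{e}_1,\ldots,\mathbf{e}_d$ the standard basis vectors. Let $\mathcal{P}=\{(p,i,s)\in\mathcal{A}^*\times\mathcal{A}\times\mathcal{A}^*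 : \sigma(j)=pis\text{ for some }j\in\mathcal{A}\}$. Stepped hypersurface. $H_\sigma=\{[\mathbf{x},i]\in\mathbb{Z}^d\times\mathcal{A} : 0\le\langle\mathbf{x},\mathbf{v}\rangle<\langle\mathbf{e}_i,\mathbf{v}\rangle\}$. A face $[\mathbf{x},i]$ is also interpreted as the $(d-1)$-dimensional cube $\{\mathbf{x}+\sum_{j\ne i}\vartheta_j\mathbf{e}_j : \vartheta_j\in[0,1]\}$. Elements of $\mathcal{A}\times H_\sigma$ are written $[i,\mathbf{x},j]$ with $i\in\mathcal{A}$, $[\mathbf{x},j]\in H_\sigma$. For $[i,\mathbf{x},j]\in\mathcal{A}\times\mathbb{Z}^d\times\mathcal{A}$ put $-[i,\mathbf{x},j]=[j,-\mathbf{x},i]$ and $\pm K=K\cup(-K)$. Ambient graph $G_{\mathfrak{D}}$. Its nodes form $\mathfrak{D}=\{[i,\mathbf{x},j]\in\mathcal{A}\times H_\sigma : \mathbf{x}=\mathbf{0}\text{ implies }i<j\}$. There is an edge $[i,\mathbf{x},j]\xrightarrow{\eta}[i',\mathbf{x}',j']$ if there are $(p_1,i,s_1),(q_1,j,t_1)\in\mathcal{P}$ with either (type 1) $\sigma(i')=p_1is_1$, $\sigma(j')=q_1jt_1$, $M\mathbf{x}'=\mathbf{x}+\mathbf{l}(q_1)-\mathbf{l}(p_1)$, or (type 2) $\sigma(j')=p_1is_1$, $\sigma(i')=q_1jt_1$, $-M\mathbf{x}'=\mathbf{x}+\mathbf{l}(q_1)-\mathbf{l}(p_1)$; the label is $\eta=\mathbf{l}(p_1)|\mathbf{l}(q_1)$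 if $\langle\mathbf{l}(p_1),\mathbf{v}\rangle\le\langle\mathbf{l}(q_1)+\mathbf{x},\mathbf{v}\rangle$ and $\eta=\mathbf{l}(q_1)|\mathbf{l}(p_1)$ otherwise. Simple ambient graph $\hat G_{\mathfrak{D}}$. Its nodes are the elements of $\pm(\mathcal{A}\times H_\sigma)\setminus\{[i,\mathbf{0},i] : i\in\mathcal{A}\}$, and there is an edge $[i,\mathbf{x},j]\xrightarrow{\mathbf{l}(p_1)|\mathbf{l}(q_1)}[i',\mathbf{x}',j']$ if there are $(p_1,i,s_1),(q_1,j,t_1)\in\mathcal{P}$ with $\sigma(i')=p_1is_1$, $\sigma(j')=q_1jt_1$ and $M\mathbf{x}'=\mathbf{x}+\mathbf{l}(q_1)-\mathbf{l}(p_1)$. Boundary (neighbor) graphs. $G_B$ (resp. $\hat G_B$) is the largest subgraph of $G_{\mathfrak{D}}$ (resp. $\hat G_{\mathfrak{D}}$) for which each node belongs to a walk that ends in a loop (a directed cycle). Contact graphs. For a directed graph $G$, $\mathrm{Red}(G)$ is the largest subgraph of $G$ having no node without an outgoing edge. Let $\mathfrak{D}_{\rm cont}=\{[i,\mathbf{x},j]\in\mathfrak{D} : [\mathbf{0},i]\cap[\mathbf{x},j]\text{ is a }(d-2)\text{-dimensional cube}\}$. The pre-contact graph $G_P$ (resp. $\hat G_P$) is the subgraph of $G_{\mathfrak{D}}$ (resp. $\hat G_{\mathfrak{D}}$) induced by all nodes from which there is a walk, possibly of length $0$, to an element of $\mathfrak{D}_{\rm cont}$ (resp. $\pm\mathfrak{D}_{\rm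 cont}$); it is known that these graphs are finite. Then $G_C=\mathrm{Red}(G_P)$, $\hat G_C=\mathrm{Red}(\hat G_P)$, and the contact set $C$ is the set of nodes of $G_C$. Corona. For a subgraph $\hat G$ of $\hat G_{\mathfrak{D}}$, $C\text{-Corona}(\hat G)$ is the subgraph of $\hat G_{\mathfrak{D}}$ induced by the set of nodes $[i_1,\mathbf{x},i_2]\in\pm(\mathcal{A}\times H_\sigma)\setminus\{[i,\mathbf{0},i] : i\in\mathcal{A}\}$ for which there is a node $[i_1,\mathbf{y},j]$ of $\hat G$ with $[j,\mathbf{x}-\mathbf{y},i_2]\in\pm C\cup\{[i,\mathbf{0},i] : i\in\mathcal{A}\}$. *)

theory Defs
  imports "HOL-Analysis.Analysis" "Graph_Theory.Graph_Theory"
begin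

section \<open>Pisot substitutions\<close>

text \<open>
  The alphabet is a finite linearly ordered type \<open>'n\<close>, playing the role of \<open>{1, \<dots>, d}\<close> with
  \<open>d = CARD('n)\<close>. An endomorphism of the free monoid is given by the images of the letters.
\<close>

type_synonym 'n subst = "'n \<Rightarrow> 'n list"

definition is_substitution :: "'n subst \<Rightarrow> bool" where
  "is_substitution \<sigma> \<longleftrightarrow> (\<forall>i. \<sigma> i \<noteq> [])"

text \<open>The abelianization of a word, taken with values in the integer lattice.\<close>

definition abel :: "'n::finite list \<Rightarrow> int ^ 'n" where
  "abel w = (\<chi> i. int (count_list w i))"

definition incidence :: "'n::finite subst \<Rightarrow> int ^ 'n ^ 'n" where
  "incidence \<sigma> = (\<chi> k i. abel (\<sigma> i) $ k)"

lemma incidence_abel_letter: "incidence \<sigma> *v abel [i] = abel (\<sigma> i)"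
proof -
  have "abel [i] = (\<chi> k. if k = i then 1 else 0)"
    by (auto simp: abel_def vec_eq_iff)
  then show ?thesis
    by (simp only:) (simp add: vec_eq_iff incidence_def matrix_vector_mult_def if_distrib cong: if_cong)
qed

definition charpoly :: "int ^ 'n ^ 'n::finite \<Rightarrow> int poly" where
  "charpoly M = det (mat [:0, 1:] - map_matrix (\<lambda>a. [:a:]) M)"

definition is_min_poly :: "rat poly \<Rightarrow> real \<Rightarrow> bool" where
  "is_min_poly f \<beta> \<longleftrightarrow> lead_coeff f = 1 \<and> poly (map_poly of_rat f) \<beta> = 0 \<and>
     (\<forall>g. g \<noteq> 0 \<and> poly (map_poly of_rat g) \<beta> = 0 \<longrightarrow> degree f \<le> degree g)"

definition pisot_number :: "real \<Rightarrow> bool" where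
  "pisot_number \<beta> \<longleftrightarrow> algebraic_int \<beta> \<and> \<beta> > 1 \<and>
     (\<forall>f z. is_min_poly f \<beta> \<and> poly (map_poly of_rat f) z = 0 \<and> z \<noteq> complex_of_real \<beta>
        \<longrightarrow> cmod z < 1)"

definition pisot_unit :: "real \<Rightarrow> bool" where
  "pisot_unit \<beta> \<longleftrightarrow> pisot_number \<beta> \<and> algebraic_int (inverse \<beta>)"

definition pisot_substitution :: "'n::finite subst \<Rightarrow> bool" where
  "pisot_substitution \<sigma> \<longleftrightarrow> is_substitution \<sigma> \<and>
     (\<exists>\<beta>. pisot_unit \<beta> \<and> is_min_poly (map_poly of_int (charpoly (incidence \<sigma>))) \<beta>)"

text \<open>
  The eigenvector \<open>v\<close> is determined only up to a positive factor; nothing below depends on this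
  factor.
\<close>

definition dominant_left_eigenvector :: "int ^ 'n ^ 'n::finite \<Rightarrow> real ^ 'n \<Rightarrow> bool" where
  "dominant_left_eigenvector M v \<longleftrightarrow> (\<forall>i. v $ i > 0) \<and>
     (\<exists>\<beta>. v v* map_matrix of_int M = \<beta> *s v \<and>
        (\<forall>z. poly (map_poly of_int (charpoly M)) z = 0 \<and> z \<noteq> complex_of_real \<beta> \<longrightarrow> cmod z < \<beta>))"

definition factorizations :: "'n subst \<Rightarrow> ('n list \<times> 'n \<times> 'n list) set" where
  "factorizations \<sigma> = {(p, i, s). \<exists>j. \<sigma> j = p @ [i] @ s}"


section \<open>The stepped hypersurface\<close>

definition real_vec :: "int ^ 'n::finite \<Rightarrow> real ^ 'n" where
  "real_vec x = (\<chi> k. real_of_int (x $ k))"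

definition stepped_surface :: "real ^ 'n::finite \<Rightarrow> ((int ^ 'n) \<times> 'n) set" where
  "stepped_surface v = {(x, i). 0 \<le> real_vec x \<bullet> v \<and> real_vec x \<bullet> v < axis i 1 \<bullet> v}"

text \<open>The unit cube with base point \<open>a\<close> spanned by the directions in \<open>S\<close>.\<close>

definition unit_cube :: "real ^ 'n::finite \<Rightarrow> 'n set \<Rightarrow> (real ^ 'n) set" where
  "unit_cube a S = {a + (\<Sum>j\<in>S. \<theta> j *\<^sub>R axis j 1) | \<theta>. \<forall>j\<in>S. 0 \<le> \<theta> j \<and> \<theta> j \<le> 1}"

definition is_cube :: "nat \<Rightarrow> (real ^ 'n::finite) set \<Rightarrow> bool" where
  "is_cube k X \<longleftrightarrow> (\<exists>a S. card S = k \<and> X = unit_cube a S)"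

definition face :: "int ^ 'n::finite \<Rightarrow> 'n \<Rightarrow> (real ^ 'n) set" where
  "face x i = unit_cube (real_vec x) (UNIV - {i})"


section \<open>Ambient graphs\<close>

type_synonym 'n node = "'n \<times> (int, 'n) vec \<times> 'n"
type_synonym 'n label = "(int, 'n) vec \<times> (int, 'n) vec"
type_synonym 'n edge = "'n node \<times> 'n label \<times> 'n node"
type_synonym 'n graph = "('n node, 'n edge) pre_digraph"

text \<open>
  An edge is the triple of its source, its label and its target. Hence two nodes are joined by at
  most one edge with a given label, even if several choices of \<open>(p, i, s)\<close> and \<open>(q, j, t)\<close>
  produce it.
\<close>

definition edge_graph :: "'n node set \<Rightarrow> 'n edge set \<Rightarrow> 'n graph" where
  "edge_graph V E = \<lparr>verts = V, arcs = {(n, \<eta>, n') \<in> E. n \<in> V \<and> n' \<in> V},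
     tail = (\<lambda>(n, \<eta>, n'). n), head = (\<lambda>(n, \<eta>, n'). n')\<rparr>"

lemma wf_edge_graph: "wf_digraph (edge_graph V E)"
  by unfold_locales (auto simp: edge_graph_def)

definition surface_nodes :: "real ^ 'n::finite \<Rightarrow> 'n node set" where
  "surface_nodes v = {(i, x, j). (x, j) \<in> stepped_surface v}"

definition neg_node :: "'n::finite node \<Rightarrow> 'n node" where
  "neg_node = (\<lambda>(i, x, j). (j, - x, i))"

definition pm :: "'n::finite node set \<Rightarrow> 'n node set" where
  "pm K = K \<union> neg_node ` K"

definition trivial_nodes :: "'n::finite node set" where
  "trivial_nodes = {(i, 0, i) | i. True}"

definition ambient_nodes :: "real ^ 'n::{finite, linorder} \<Rightarrow> 'n node set" where
  "ambient_nodes v = {(i, x, j) \<in> surface_nodes v. x = 0 \<longrightarrow> i < j}"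

definition simple_ambient_nodes :: "real ^ 'n::finite \<Rightarrow> 'n node set" where
  "simple_ambient_nodes v = pm (surface_nodes v) - trivial_nodes"

definition ambient_edges :: "'n::finite subst \<Rightarrow> real ^ 'n \<Rightarrow> 'n edge set" where
  "ambient_edges \<sigma> v = {((i, x, j), \<eta>, (i', x', j')). \<exists>p s q t.
     (p, i, s) \<in> factorizations \<sigma> \<and> (q, j, t) \<in> factorizations \<sigma> \<and>
     (\<sigma> i' = p @ [i] @ s \<and> \<sigma> j' = q @ [j] @ t \<and>
        incidence \<sigma> *v x' = x + abel q - abel p
      \<or> \<sigma> j' = p @ [i] @ s \<and> \<sigma> i' = q @ [j] @ t \<and>
        - (incidence \<sigma> *v x') = x + abel q - abel p) \<and>
     \<eta> = (if real_vec (abel p) \<bullet> v \<le> real_vec (abel q + x) \<bullet> v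
          then (abel p, abel q) else (abel q, abel p))}"

definition simple_ambient_edges :: "'n::finite subst \<Rightarrow> 'n edge set" where
  "simple_ambient_edges \<sigma> = {((i, x, j), \<eta>, (i', x', j')). \<exists>p s q t.
     (p, i, s) \<in> factorizations \<sigma> \<and> (q, j, t) \<in> factorizations \<sigma> \<and>
     \<sigma> i' = p @ [i] @ s \<and> \<sigma> j' = q @ [j] @ t \<and>
     incidence \<sigma> *v x' = x + abel q - abel p \<and> \<eta> = (abel p, abel q)}"

definition ambient_graph :: "'n subst \<Rightarrow> real ^ 'n::{finite, linorder} \<Rightarrow> 'n graph" where
  "ambient_graph \<sigma> v = edge_graph (ambient_nodes v) (ambient_edges \<sigma> v)"

definition simple_ambient_graph :: "'n::finite subst \<Rightarrow> real ^ 'n \<Rightarrow> 'n graph" where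
  "simple_ambient_graph \<sigma> v = edge_graph (simple_ambient_nodes v) (simple_ambient_edges \<sigma>)"


section \<open>Largest subgraphs\<close>

definition largest_subgraph :: "(('a, 'b) pre_digraph \<Rightarrow> bool) \<Rightarrow> ('a, 'b) pre_digraph
    \<Rightarrow> ('a, 'b) pre_digraph" where
  "largest_subgraph P G =
     (THE H. subgraph H G \<and> P H \<and> (\<forall>K. subgraph K G \<and> P K \<longrightarrow> subgraph K H))"

definition all_nodes_to_loop :: "('a, 'b) pre_digraph \<Rightarrow> bool" where
  "all_nodes_to_loop G \<longleftrightarrow> (\<forall>n \<in> verts G. \<exists>u p q w.
     pre_digraph.awalk G u (p @ q) w \<and> pre_digraph.cycle G q \<and>
     n \<in> set (pre_digraph.awalk_verts G u (p @ q)))"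

definition no_sinks :: "('a, 'b) pre_digraph \<Rightarrow> bool" where
  "no_sinks G \<longleftrightarrow> (\<forall>n \<in> verts G. out_arcs G n \<noteq> {})"

definition loop_part :: "('a, 'b) pre_digraph \<Rightarrow> ('a, 'b) pre_digraph" where
  "loop_part G = largest_subgraph all_nodes_to_loop G"

definition Red :: "('a, 'b) pre_digraph \<Rightarrow> ('a, 'b) pre_digraph" where
  "Red G = largest_subgraph no_sinks G"

text \<open>
  Both properties say that every node \<open>n\<close> of \<open>G\<close> satisfies some condition that persists in larger
  graphs. For such properties the largest subgraph exists, so the description above is proper.
\<close>

lemma subgraph_antisym: "subgraph H K \<Longrightarrow> subgraph K H \<Longrightarrow> H = K"
  by (auto simp: subgraph_def compatible_def intro!: pre_digraph.equality)

lemma largest_subgraph_equality: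
  assumes "subgraph H G" "P H" "\<And>K. subgraph K G \<Longrightarrow> P K \<Longrightarrow> subgraph K H"
  shows "largest_subgraph P G = H"
  unfolding largest_subgraph_def
proof (rule the_equality)
  fix H' assume "subgraph H' G \<and> P H' \<and> (\<forall>K. subgraph K G \<and> P K \<longrightarrow> subgraph K H')"
  then have "subgraph H H'" "subgraph H' H" using assms by auto
  then show "H' = H" by (rule subgraph_antisym[rotated])
qed (use assms in auto)

lemma largest_subgraph_exists:
  assumes wf: "wf_digraph G"
    and mono: "\<And>H K n. subgraph H K \<Longrightarrow> Q H n \<Longrightarrow> Q K n"
    and P: "\<And>H. P H \<longleftrightarrow> (\<forall>n \<in> verts H. Q H n)"
  shows "subgraph (largest_subgraph P G) G" "P (largest_subgraph P G)"
    "subgraph K G \<Longrightarrow> P K \<Longrightarrow> subgraph K (largest_subgraph P G)"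
proof -
  define U where "U = pre_digraph.Union G {H. subgraph H G \<and> P H}"
  have U: "verts U = (\<Union>H \<in> {H. subgraph H G \<and> P H}. verts H)"
    "arcs U = (\<Union>H \<in> {H. subgraph H G \<and> P H}. arcs H)" "tail U = tail G" "head U = head G"
    by (auto simp: U_def pre_digraph.Union_def)
  have wfU: "wf_digraph U"
  proof
    fix e assume "e \<in> arcs U"
    then obtain H where H: "subgraph H G" "P H" "e \<in> arcs H" unfolding U by auto
    then have "tail H e \<in> verts H" "head H e \<in> verts H"
      by (auto simp: subgraph_def wf_digraph_def)
    with H show "tail U e \<in> verts U" "head U e \<in> verts U"
      by (auto simp: U subgraph_def compatible_def)
  qed
  have UG: "subgraph U G"
    using wf wfU by (auto simp: subgraph_def compatible_def U)
  have sub: "subgraph H U" if "subgraph H G" "P H" for H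
    using that wfU by (auto simp: subgraph_def compatible_def U)
  have PU: "P U"
    unfolding P
  proof
    fix n assume "n \<in> verts U"
    then obtain H where H: "subgraph H G" "P H" "n \<in> verts H" unfolding U by auto
    then have "Q H n" using P by blast
    with sub[OF H(1,2)] show "Q U n" by (rule mono)
  qed
  have "largest_subgraph P G = U"
    by (rule largest_subgraph_equality) (use UG PU sub in auto)
  with UG PU sub show "subgraph (largest_subgraph P G) G" "P (largest_subgraph P G)"
    "subgraph K G \<Longrightarrow> P K \<Longrightarrow> subgraph K (largest_subgraph P G)"
    by simp_all
qed

lemma cas_subgraph: "subgraph H K \<Longrightarrow> pre_digraph.cas H u p w \<longleftrightarrow> pre_digraph.cas K u p w"
  by (induction p arbitrary: u)
    (auto simp: subgraph_def compatible_def pre_digraph.cas.simps)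

lemma awalk_verts_subgraph:
  "subgraph H K \<Longrightarrow> pre_digraph.awalk_verts H u p = pre_digraph.awalk_verts K u p"
  by (induction p arbitrary: u)
    (auto simp: subgraph_def compatible_def pre_digraph.awalk_verts.simps)

lemma awalk_subgraph: "subgraph H K \<Longrightarrow> pre_digraph.awalk H u p w \<Longrightarrow> pre_digraph.awalk K u p w"
  using cas_subgraph[of H K u p w] by (auto simp: pre_digraph.awalk_def subgraph_def)

lemma cycle_subgraph: "subgraph H K \<Longrightarrow> pre_digraph.cycle H q \<Longrightarrow> pre_digraph.cycle K q"
  unfolding pre_digraph.cycle_def using awalk_subgraph[of H K] awalk_verts_subgraph[of H K] by auto

lemma loop_part_largest:
  assumes "wf_digraph G"
  shows "subgraph (loop_part G) G" "all_nodes_to_loop (loop_part G)"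
    "subgraph K G \<Longrightarrow> all_nodes_to_loop K \<Longrightarrow> subgraph K (loop_part G)"
proof -
  let ?Q = "\<lambda>H n. \<exists>u p q w. pre_digraph.awalk H u (p @ q) w \<and> pre_digraph.cycle H q \<and>
     n \<in> set (pre_digraph.awalk_verts H u (p @ q))"
  have "?Q K' n" if "subgraph H K'" "?Q H n" for H K' :: "('a, 'b) pre_digraph" and n
    using that(2) awalk_subgraph[OF that(1)] awalk_verts_subgraph[OF that(1)]
      cycle_subgraph[OF that(1)] by fastforce
  note * = largest_subgraph_exists[OF assms, of ?Q all_nodes_to_loop, OF this all_nodes_to_loop_def]
  show "subgraph (loop_part G) G" "all_nodes_to_loop (loop_part G)"
    "subgraph K G \<Longrightarrow> all_nodes_to_loop K \<Longrightarrow> subgraph K (loop_part G)"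
    unfolding loop_part_def by (rule *; assumption)+
qed

lemma Red_largest:
  assumes "wf_digraph G"
  shows "subgraph (Red G) G" "no_sinks (Red G)"
    "subgraph K G \<Longrightarrow> no_sinks K \<Longrightarrow> subgraph K (Red G)"
proof -
  let ?Q = "\<lambda>H n. out_arcs H n \<noteq> {}"
  have "?Q K' n" if "subgraph H K'" "?Q H n" for H K' :: "('a, 'b) pre_digraph" and n
    using that by (auto simp: out_arcs_def subgraph_def compatible_def)
  note * = largest_subgraph_exists[OF assms, of ?Q no_sinks, OF this no_sinks_def]
  show "subgraph (Red G) G" "no_sinks (Red G)"
    "subgraph K G \<Longrightarrow> no_sinks K \<Longrightarrow> subgraph K (Red G)"
    unfolding Red_def by (rule *; assumption)+
qed


section \<open>Boundary graphs, contact graphs and the corona\<close>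

definition boundary_graph :: "'n subst \<Rightarrow> real ^ 'n::{finite, linorder} \<Rightarrow> 'n graph" where
  "boundary_graph \<sigma> v = loop_part (ambient_graph \<sigma> v)"

definition simple_boundary_graph :: "'n::finite subst \<Rightarrow> real ^ 'n \<Rightarrow> 'n graph" where
  "simple_boundary_graph \<sigma> v = loop_part (simple_ambient_graph \<sigma> v)"

definition contact_nodes :: "real ^ 'n::{finite, linorder} \<Rightarrow> 'n node set" where
  "contact_nodes v = {(i, x, j) \<in> ambient_nodes v. is_cube (CARD('n) - 2) (face 0 i \<inter> face x j)}"

definition pre_contact_graph :: "'n subst \<Rightarrow> real ^ 'n::{finite, linorder} \<Rightarrow> 'n graph" where
  "pre_contact_graph \<sigma> v = ambient_graph \<sigma> v \<restriction>
     {n \<in> verts (ambient_graph \<sigma> v). \<exists>m \<in> contact_nodes v. reachable (ambient_graph \<sigma> v) n m}"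

definition simple_pre_contact_graph :: "'n subst \<Rightarrow> real ^ 'n::{finite, linorder} \<Rightarrow> 'n graph" where
  "simple_pre_contact_graph \<sigma> v = simple_ambient_graph \<sigma> v \<restriction>
     {n \<in> verts (simple_ambient_graph \<sigma> v).
        \<exists>m \<in> pm (contact_nodes v). reachable (simple_ambient_graph \<sigma> v) n m}"

definition contact_graph :: "'n subst \<Rightarrow> real ^ 'n::{finite, linorder} \<Rightarrow> 'n graph" where
  "contact_graph \<sigma> v = Red (pre_contact_graph \<sigma> v)"

definition simple_contact_graph :: "'n subst \<Rightarrow> real ^ 'n::{finite, linorder} \<Rightarrow> 'n graph" where
  "simple_contact_graph \<sigma> v = Red (simple_pre_contact_graph \<sigma> v)"

definition contact_set :: "'n subst \<Rightarrow> real ^ 'n::{finite, linorder} \<Rightarrow> 'n node set" where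
  "contact_set \<sigma> v = verts (contact_graph \<sigma> v)"

definition corona ::
    "'n subst \<Rightarrow> real ^ 'n::{finite, linorder} \<Rightarrow> 'n graph \<Rightarrow> 'n graph" where
  "corona \<sigma> v G = simple_ambient_graph \<sigma> v \<restriction>
     {(i\<^sub>1, x, i\<^sub>2) \<in> simple_ambient_nodes v. \<exists>y j. (i\<^sub>1, y, j) \<in> verts G \<and>
        (j, x - y, i\<^sub>2) \<in> pm (contact_set \<sigma> v) \<union> trivial_nodes}"

text \<open>The sequence \<open>A[1], A[2], \<dots>\<close> computed by the algorithm; it is only used for \<open>p \<ge> 1\<close>.\<close>

definition neighbor_iterate ::
    "'n subst \<Rightarrow> real ^ 'n::{finite, linorder} \<Rightarrow> nat \<Rightarrow> 'n graph" where
  "neighbor_iterate \<sigma> v p = ((\<lambda>G. Red (corona \<sigma> v G)) ^^ (p - 1)) (simple_contact_graph \<sigma> v)"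

lemma neighbor_iterate_1: "neighbor_iterate \<sigma> v 1 = simple_contact_graph \<sigma> v"
  by (simp add: neighbor_iterate_def)

lemma neighbor_iterate_step:
  assumes "p \<ge> 2"
  shows "neighbor_iterate \<sigma> v p = Red (corona \<sigma> v (neighbor_iterate \<sigma> v (p - 1)))"
proof -
  from assms obtain k where "p = Suc (Suc k)"
    using le_Suc_ex by force
  then show ?thesis by (simp add: neighbor_iterate_def)
qed

end

theory Submission
  imports Defs "HOL-Computational_Algebra.Fundamental_Theorem_Algebra"
begin

text \<open>
  A node \<open>[i, x, j]\<close> records the overlap of the intervals \<open>[0, v\<^sub>i)\<close> and \<open>[-\<langle>x, v\<rangle>, -\<langle>x, v\<rangle> + v\<^sub>j)\<close>.
  Along the coordinates given by the left eigenvectors for the contracting eigenvalues, an edge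
  \<open>a \<rightarrow> b\<close> bounds \<open>a\<close> in terms of \<open>b\<close>; hence a finite set of nodes in which every node has a successor
  lies in a fixed finite set, and the iterates of the algorithm form an increasing chain inside
  the finite neighbor graph. Conversely, let \<open>A\<close> be the final iterate and follow a neighbor node along
  an infinite walk in a finite set. At a late level the two faces of the current pair are joined in
  a stepped surface by a chain of faces, of bounded length, with consecutive faces in contact.
  Every face has a unique parent under the dual substitution, so the chain can be pulled back
  along the walk. By the pigeonhole principle the pulled back steps lie in the contact graph after
  boundedly many levels, and one face of the chain after another enters \<open>A\<close>, because \<open>A\<close> is a fixed
  point of the reduced corona.
\<close>

section \<open>Contracting coordinates of a Pisot substitution\<close>

text \<open>The obstacle is that a chain of contact steps need not consist of nodes of the contact
  graph: contact is a geometric condition, and a contact node may a priori be lost in the reduction,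
  whereas the corona is built with \<open>contact_set\<close>. Nor is membership in a corona enough,
  since a fixed point absorbs only those corona nodes from which walks inside the corona continue.
  Both defects are repaired by spending levels: a pair that has a walk of \<open>N\<close> steps
  ahead of it inside a set of at most \<open>N\<close> nodes lies in the reduction of that set. Each
  chain step thus costs \<open>N\<close> levels, so the length of the chain must be controlled
  before the level at which it is built is chosen. Pulling back a whole chain also requires all its
  faces to lie on one stepped surface and their parents on one again. Hence the surfaces carry
  heights, transported by \<open>t r = \<beta> * t (Suc r) - word_length v (p r)\<close>, for which
  the first face of every pair keeps base point zero.\<close>

lemma poly_map_of_int_add:
  "poly (map_poly of_int (p + q)) (z::'a::comm_ring_1) =
     poly (map_poly of_int p) z + poly (map_poly of_int q) z"
proof -
  have "map_poly of_int (p + q) = (map_poly of_int p + map_poly of_int q :: 'a poly)"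
    by (rule poly_eqI) (simp add: coeff_map_poly)
  then show ?thesis by simp
qed

lemma poly_map_of_int_mult:
  "poly (map_poly of_int (p * q)) (z::'a::comm_ring_1) =
     poly (map_poly of_int p) z * poly (map_poly of_int q) z"
proof -
  have "map_poly of_int (p * q) = (map_poly of_int p * map_poly of_int q :: 'a poly)"
    by (rule poly_eqI) (simp add: coeff_map_poly coeff_mult)
  then show ?thesis by simp
qed

lemma poly_map_of_int_sum:
  "poly (map_poly of_int (sum f A)) (z::'a::comm_ring_1) = (\<Sum>x\<in>A. poly (map_poly of_int (f x)) z)"
  by (induction A rule: infinite_finite_induct) (simp_all add: poly_map_of_int_add)

lemma poly_map_of_int_prod:
  "poly (map_poly of_int (prod f A)) (z::'a::comm_ring_1) = (\<Prod>x\<in>A. poly (map_poly of_int (f x)) z)"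
  by (induction A rule: infinite_finite_induct) (simp_all add: poly_map_of_int_mult)

text \<open>The Leibniz formula is polynomial in the entries, so evaluation passes through the
  determinant. The ring of \<open>z\<close> is kept general because both real and complex roots are
  needed.\<close>

lemma poly_charpoly:
  fixes M :: "int ^ 'n ^ 'n::finite" and z :: "'a::comm_ring_1"
  shows "poly (map_poly of_int (charpoly M)) z = det (mat z - map_matrix of_int M)"
proof -
  have 1: "poly (map_poly of_int ((mat [:0, 1:] - map_matrix (\<lambda>a. [:a:]) M :: int poly ^ 'n ^ 'n) $ i $ j)) z
      = (mat z - map_matrix of_int M) $ i $ j" for i j
    by (simp add: mat_def map_poly_pCons)
  show ?thesis
    unfolding charpoly_def det_def poly_map_of_int_sum
    by (rule sum.cong[OF refl])
      (simp only: poly_map_of_int_mult poly_map_of_int_prod 1 of_int_poly, simp add: map_poly_pCons)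
qed

text \<open>Every permutation other than the identity picks a constant off-diagonal entry and so
  gives a product of smaller degree. The coefficient yields the lower bound on the number of roots
  from which a basis of eigenvectors is built.\<close>

lemma coeff_charpoly_card:
  fixes M :: "int ^ 'n ^ 'n::finite"
  shows "coeff (charpoly M) CARD('n) = 1"
proof -
  define A where "A = (mat [:0, 1:] - map_matrix (\<lambda>a. [:a:]) M :: int poly ^ 'n ^ 'n)"
  have A: "A $ i $ j = (if i = j then [:- (M $ i $ i), 1:] else [:- (M $ i $ j):])" for i j
    by (simp add: A_def mat_def)
  have deg: "degree (A $ i $ j) = (if i = j then 1 else 0)" for i j
    by (simp add: A)
  define c where "c p = coeff (of_int (sign p) * (\<Prod>i\<in>UNIV. A $ i $ p i)) CARD('n)" for p
  have id: "c id = 1"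
  proof -
    have "degree (\<Prod>i\<in>UNIV. A $ i $ i) = CARD('n)"
      by (subst degree_prod_eq_sum_degree) (auto simp: A deg)
    moreover have "lead_coeff (\<Prod>i\<in>UNIV. A $ i $ i) = 1"
      by (simp add: lead_coeff_prod A)
    ultimately show ?thesis by (simp add: c_def)
  qed
  have other: "c p = 0" if "p \<noteq> id" for p
  proof -
    from that obtain k where k: "p k \<noteq> k" by (metis eq_id_iff)
    have "degree (\<Prod>i\<in>UNIV. A $ i $ p i) \<le> (\<Sum>i\<in>UNIV. if i = p i then 1 else 0)"
      using degree_prod_sum_le[of UNIV "\<lambda>i. A $ i $ p i"] by (simp add: deg)
    also have "\<dots> < (\<Sum>i\<in>(UNIV::'n set). 1)"
      by (rule sum_strict_mono_ex1) (use k in \<open>auto intro!: exI[of _ k]\<close>)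
    finally have "coeff (\<Prod>i\<in>UNIV. A $ i $ p i) CARD('n) = 0"
      by (intro coeff_eq_0) simp
    then show ?thesis by (simp add: c_def of_int_poly)
  qed
  have "coeff (charpoly M) CARD('n) = (\<Sum>p\<in>{p. p permutes UNIV}. c p)"
    by (simp add: charpoly_def det_def coeff_sum c_def A_def)
  also have "\<dots> = (\<Sum>p\<in>{id}. c p)"
    by (rule sum.mono_neutral_right) (auto simp: other permutes_id)
  finally show ?thesis by (simp add: id)
qed

text \<open>A vanishing determinant means dependent rows, and the coefficients of a dependency
  between the rows of \<open>mat z - M\<close> are the entries of a left eigenvector.\<close>

lemma left_eigenvector_iff:
  fixes M :: "int ^ 'n ^ 'n::finite" and z :: "'a::field"
  shows "poly (map_poly of_int (charpoly M)) z = 0 \<longleftrightarrow>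
    (\<exists>w :: 'a ^ 'n. w \<noteq> 0 \<and> (\<forall>j. (\<Sum>i\<in>UNIV. w $ i * of_int (M $ i $ j)) = z * w $ j))"
proof -
  define A where "A = (mat z - map_matrix of_int M :: 'a ^ 'n ^ 'n)"
  have comp: "(\<Sum>i\<in>UNIV. c i *s row i A) = 0 \<longleftrightarrow>
      (\<forall>j. (\<Sum>i\<in>UNIV. c i * of_int (M $ i $ j)) = z * c j)" for c
  proof -
    have "(\<Sum>i\<in>UNIV. c i * A $ i $ j) = z * c j - (\<Sum>i\<in>UNIV. c i * of_int (M $ i $ j))" for j
      by (simp add: A_def mat_def right_diff_distrib sum_subtractf if_distrib[of "\<lambda>x. c _ * x"] cong: if_cong)
    then show ?thesis
      by (auto simp: vec_eq_iff row_def)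
  qed
  have "poly (map_poly of_int (charpoly M)) z = 0 \<longleftrightarrow> \<not> (\<exists>B. A ** B = mat 1)"
    by (simp add: poly_charpoly A_def invertible_det_nz flip: invertible_right_inverse)
  also have "\<dots> \<longleftrightarrow> (\<exists>c. (\<forall>j. (\<Sum>i\<in>UNIV. c i * of_int (M $ i $ j)) = z * c j) \<and> (\<exists>i. c i \<noteq> 0))"
    unfolding matrix_right_invertible_independent_rows comp by auto
  also have "\<dots> \<longleftrightarrow> (\<exists>w :: 'a ^ 'n. w \<noteq> 0 \<and> (\<forall>j. (\<Sum>i\<in>UNIV. w $ i * of_int (M $ i $ j)) = z * w $ j))"
    (is "?l \<longleftrightarrow> ?r")
  proof
    assume ?l
    then obtain c where "(\<forall>j. (\<Sum>i\<in>UNIV. c i * of_int (M $ i $ j)) = z * c j)" "\<exists>i. c i \<noteq> 0" by blast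
    then show ?r by (intro exI[of _ "\<chi> i. c i"]) (auto simp: vec_eq_iff)
  next
    assume ?r
    then obtain w :: "'a ^ 'n" where w: "w \<noteq> 0" "\<forall>j. (\<Sum>i\<in>UNIV. w $ i * of_int (M $ i $ j)) = z * w $ j"
      by blast
    then show ?l by (intro exI[of _ "\<lambda>i. w $ i"]) (auto simp: vec_eq_iff)
  qed
  finally show ?thesis .
qed

text \<open>Applying \<open>T - a\<close> removes the vector with eigenvalue \<open>a\<close> and
  rescales each other one by \<open>z - a\<close>, which is nonzero. The coefficients of a linear
  relation are absorbed into the \<open>w z\<close>, which therefore may vanish.\<close>

lemma eigenvectors_independent:
  fixes T :: "'b::ab_group_add \<Rightarrow> 'b" and scale :: "complex \<Rightarrow> 'b \<Rightarrow> 'b"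
  assumes "vector_space scale" "finite Z"
    and T: "\<And>x y. T (x + y) = T x + T y" "\<And>a x. T (scale a x) = scale a (T x)"
    and "\<And>z. z \<in> Z \<Longrightarrow> T (w z) = scale z (w z)"
    and "(\<Sum>z\<in>Z. w z) = 0" and "z \<in> Z"
  shows "w z = 0"
  using assms(2,5-7)
proof (induction Z arbitrary: w z rule: finite_induct)
  case empty
  then show ?case by simp
next
  case (insert a Z)
  interpret vector_space scale by fact
  have T0: "T 0 = 0" using T(1)[of 0 0] by simp
  have Tsum: "T (sum f A) = (\<Sum>x\<in>A. T (f x))" if "finite A" for f :: "complex \<Rightarrow> 'b" and A
    using that by (induction A rule: finite_induct) (simp_all add: T0 T(1))
  define u where "u b = scale (b - a) (w b)" for b
  have s0: "w a + (\<Sum>b\<in>Z. w b) = 0" using insert by simp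
  have "(\<Sum>b\<in>insert a Z. u b) = (\<Sum>b\<in>insert a Z. T (w b) - scale a (w b))"
    unfolding u_def using insert.prems(1) by (intro sum.cong[OF refl]) (simp add: scale_left_diff_distrib)
  also have "\<dots> = T (\<Sum>b\<in>insert a Z. w b) - scale a (\<Sum>b\<in>insert a Z. w b)"
    using Tsum[of "insert a Z" w] insert.hyps(1)
    by (simp only: sum_subtractf scale_sum_right finite_insert)
  also have "\<dots> = 0" using insert.prems(2) T0 by simp
  finally have "(\<Sum>b\<in>Z. u b) = 0"
    using insert.hyps by (simp add: u_def)
  have uz: "u b = 0" if "b \<in> Z" for b
  proof (rule insert.IH[OF _ \<open>(\<Sum>b\<in>Z. u b) = 0\<close> that])
    fix c assume "c \<in> Z"
    then show "T (u c) = scale c (u c)"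
      using insert.prems(1)[of c] by (simp add: u_def T(2) mult.commute)
  qed
  have wz: "w b = 0" if "b \<in> Z" for b
    using uz[OF that] that insert.hyps(2) by (auto simp: u_def)
  then have "w a = 0" using s0 by simp
  with wz insert.prems(3) show ?case by blast
qed

text \<open>Minimality of the degree makes the polynomial irreducible, hence separable.\<close>

lemma is_min_poly_simple_roots:
  fixes z :: complex
  assumes min: "is_min_poly f \<beta>" and "poly (map_poly of_rat f) z = 0"
  shows "poly (pderiv (map_poly of_rat f)) z \<noteq> 0"
proof
  assume dz: "poly (pderiv (map_poly of_rat f)) z = 0"
  have mult: "map_poly of_rat (p * q) = (map_poly of_rat p * map_poly of_rat q :: 'a::field_char_0 poly)" for p q
    by (rule poly_eqI) (simp add: coeff_map_poly coeff_mult of_rat_sum of_rat_mult)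
  have add: "map_poly of_rat (p + q) = (map_poly of_rat p + map_poly of_rat q :: 'a::field_char_0 poly)" for p q
    by (rule poly_eqI) (simp add: coeff_map_poly of_rat_add)
  have f: "lead_coeff f = 1" "poly (map_poly of_rat f) \<beta> = 0" "f \<noteq> 0"
    "\<And>g. g \<noteq> 0 \<Longrightarrow> poly (map_poly of_rat g) \<beta> = 0 \<Longrightarrow> degree f \<le> degree g"
    using min by (auto simp: is_min_poly_def)
  have degf: "degree f > 0"
  proof (rule ccontr)
    assume "\<not> degree f > 0"
    then obtain c where "f = [:c:]" using degree_eq_zeroE by blast
    with f show False by (simp add: map_poly_pCons)
  qed
  \<comment> \<open>Let \<open>m\<close> be a rational polynomial of least degree vanishing at
    \<open>z\<close>. It divides \<open>f\<close>, and since \<open>m\<close> or the cofactor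
    vanishes at \<open>\<beta>\<close>, minimality of \<open>f\<close> forces equal degrees. The
    derivative, of smaller degree, then cannot vanish at \<open>z\<close>.\<close>
  define P where "P g \<longleftrightarrow> g \<noteq> 0 \<and> poly (map_poly of_rat g) z = 0" for g
  have "P f" using assms(2) f(3) by (simp add: P_def)
  then obtain m where m: "P m" "\<And>g. P g \<Longrightarrow> degree m \<le> degree g"
    by (metis ex_has_least_nat)
  have mdvd: "f = m * (f div m)"
  proof -
    have eq: "f = m * (f div m) + f mod m" by simp
    have "poly (map_poly of_rat f) z = poly (map_poly of_rat m) z * poly (map_poly of_rat (f div m)) z + poly (map_poly of_rat (f mod m)) z"
      by (subst eq) (simp only: mult add poly_add poly_mult)
    then have "poly (map_poly of_rat (f mod m)) z = 0"
      using assms(2) m(1) by (simp add: P_def)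
    moreover have "f mod m = 0 \<or> degree (f mod m) < degree m"
      using degree_mod_less m(1) P_def by blast
    ultimately have "f mod m = 0" using m(2)[of "f mod m"] unfolding P_def by linarith
    then show ?thesis using eq by simp
  qed
  have m0: "m \<noteq> 0" using m(1) P_def by blast
  have dm: "degree m > 0"
  proof (rule ccontr)
    assume "\<not> degree m > 0"
    then obtain c where "m = [:c:]" using degree_eq_zeroE by blast
    with m(1) show False by (simp add: P_def map_poly_pCons)
  qed
  have h0: "f div m \<noteq> 0" using f(3) mdvd by auto
  have degs: "degree f = degree m + degree (f div m)"
    by (metis mdvd degree_mult_eq h0 m0)
  have "poly (map_poly of_rat f) \<beta> = poly (map_poly of_rat m) \<beta> * poly (map_poly of_rat (f div m)) \<beta>"
    by (metis mdvd mult poly_mult)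
  then have "poly (map_poly of_rat m) \<beta> = 0 \<or> poly (map_poly of_rat (f div m)) \<beta> = 0"
    using f(2) by auto
  then have "degree f \<le> degree m"
    using f(4)[OF h0] f(4)[OF m0] degs dm by auto
  moreover have "P (pderiv f)"
  proof -
    have "pderiv (map_poly of_rat f) = (map_poly of_rat (pderiv f) :: complex poly)"
      by (rule poly_eqI) (simp add: coeff_map_poly coeff_pderiv of_rat_mult of_rat_add)
    then show ?thesis using dz degf by (auto simp: P_def pderiv_eq_0_iff)
  qed
  then have "degree m \<le> degree (pderiv f)" by (rule m(2))
  ultimately show False using degf by (simp add: degree_pderiv)
qed

section \<open>Lattice points with bounded eigen-coordinates\<close>

lemma finite_int_vec_bounded: "finite {x :: int ^ 'n::finite. \<forall>k. \<bar>x $ k\<bar> \<le> b}"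
proof -
  have "{x :: int ^ 'n. \<forall>k. \<bar>x $ k\<bar> \<le> b} \<subseteq> vec_lambda ` (PiE UNIV (\<lambda>_. {-b..b}))"
  proof
    fix x :: "int ^ 'n" assume "x \<in> {x. \<forall>k. \<bar>x $ k\<bar> \<le> b}"
    then have "vec_nth x \<in> PiE UNIV (\<lambda>_. {-b..b})" by (auto simp: abs_le_iff minus_le_iff)
    then show "x \<in> vec_lambda ` (PiE UNIV (\<lambda>_. {-b..b}))"
      by (metis image_eqI vec_nth_inverse)
  qed
  then show ?thesis by (rule finite_subset) (intro finite_imageI finite_PiE, auto)
qed

text \<open>A bilinear pairing without complex conjugation: for a left eigenvector \<open>w\<close>
  with eigenvalue \<open>z\<close>, the incidence matrix acts on this coordinate as multiplication
  by \<open>z\<close> itself.\<close>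

definition coord :: "complex ^ 'n \<Rightarrow> int ^ 'n::finite \<Rightarrow> complex" where
  "coord w x = (\<Sum>k\<in>UNIV. w $ k * of_int (x $ k))"

lemma coord_add: "coord w (x + y) = coord w x + coord w y"
  by (simp add: coord_def algebra_simps sum.distrib)

text \<open>The characteristic polynomial is separable, so there are enough distinct eigenvalues for
  the left eigenvectors to form a basis. Bounding all coordinates then bounds the vector, and only
  finitely many lattice points remain. \<open>Z\<close> consists of the roots other than
  \<open>\<beta>\<close>.\<close>

lemma pisot_coordinates:
  fixes v :: "real ^ 'n::finite" and \<sigma> :: "'n subst"
  defines "M \<equiv> incidence \<sigma>"
  assumes "pisot_substitution \<sigma>" "dominant_left_eigenvector M v"
  obtains \<beta> :: real and Z :: "complex set" and w :: "complex \<Rightarrow> complex ^ 'n"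
  where "\<beta> > 1" "v v* map_matrix of_int M = \<beta> *s v" "finite Z"
    "\<And>z. z \<in> Z \<Longrightarrow> cmod z < 1"
    "\<And>z x. z \<in> Z \<Longrightarrow> coord (w z) (M *v x) = z * coord (w z) x"
    "\<And>B. finite {x. \<bar>real_vec x \<bullet> v\<bar> \<le> B \<and> (\<forall>z\<in>Z. cmod (coord (w z) x) \<le> B)}"
proof -
  from assms(2) obtain \<beta>' where pis: "pisot_unit \<beta>'"
    and min: "is_min_poly (map_poly of_int (charpoly M)) \<beta>'"
    unfolding pisot_substitution_def M_def by blast
  define ch :: "complex poly" where "ch = map_poly of_int (charpoly M)"
  have ch: "map_poly of_rat (map_poly of_int (charpoly M)) = ch"
    by (simp add: ch_def map_poly_map_poly o_def)
  from assms(3) obtain \<beta> where vpos: "\<And>i. v $ i > 0"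
    and ev: "v v* map_matrix of_int M = \<beta> *s v"
    and dom: "\<And>z. poly ch z = 0 \<Longrightarrow> z \<noteq> complex_of_real \<beta> \<Longrightarrow> cmod z < \<beta>"
    unfolding dominant_left_eigenvector_def ch_def by blast
  have vj: "(\<Sum>i\<in>UNIV. v $ i * of_int (M $ i $ j)) = \<beta> * v $ j" for j
    using arg_cong[OF ev, of "\<lambda>x. x $ j"] by (simp add: vector_matrix_mult_def mult.commute)
  define vc :: "complex ^ 'n" where "vc = (\<chi> i. of_real (v $ i))"
  have "vc \<noteq> 0" using vpos by (auto simp: vc_def vec_eq_iff) (metis less_irrefl)
  have vcj: "(\<Sum>i\<in>UNIV. vc $ i * of_int (M $ i $ j)) = of_real \<beta> * vc $ j" for j
    using arg_cong[OF vj[of j], of complex_of_real] by (simp add: vc_def)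
  have root_\<beta>: "poly ch (of_real \<beta>) = 0"
    unfolding ch_def left_eigenvector_iff using \<open>vc \<noteq> 0\<close> vcj by blast
  have pisot: "\<beta>' > 1" "\<And>z. poly ch z = 0 \<Longrightarrow> z \<noteq> complex_of_real \<beta>' \<Longrightarrow> cmod z < 1"
    using pis min unfolding pisot_unit_def pisot_number_def ch[symmetric] by blast+
  have root_\<beta>': "poly ch (of_real \<beta>') = 0"
  proof -
    have "poly (map_poly of_rat (map_poly of_int (charpoly M))) \<beta>' = 0"
      using min by (simp add: is_min_poly_def)
    then have "poly (map_poly of_int (charpoly M)) \<beta>' = 0"
      by (simp add: map_poly_map_poly o_def)
    then obtain w :: "real ^ 'n" where w: "w \<noteq> 0"
        "\<And>j. (\<Sum>i\<in>UNIV. w $ i * of_int (M $ i $ j)) = \<beta>' * w $ j"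
      unfolding left_eigenvector_iff by blast
    have "(\<chi> i. complex_of_real (w $ i)) \<noteq> 0"
      using w(1) by (auto simp: vec_eq_iff)
    moreover have "(\<Sum>i\<in>UNIV. (\<chi> i. complex_of_real (w $ i)) $ i * of_int (M $ i $ j))
        = of_real \<beta>' * (\<chi> i. complex_of_real (w $ i)) $ j" for j
      using arg_cong[OF w(2)[of j], of complex_of_real] by simp
    ultimately show ?thesis
      unfolding ch_def left_eigenvector_iff by blast
  qed
  \<comment> \<open>\<open>\<beta>'\<close> is the Pisot unit and \<open>\<beta>\<close> the
    eigenvalue belonging to \<open>v\<close>. If they differed, the Pisot property would give
    \<beta> < 1, while dominance would give \<beta> > \<beta>' > 1.\<close>
  have eq: "\<beta>' = \<beta>"
  proof (rule ccontr)
    assume "\<beta>' \<noteq> \<beta>"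
    then have "cmod (of_real \<beta>') < \<beta>" "cmod (of_real \<beta>) < 1"
      using dom[OF root_\<beta>'] pisot(2)[OF root_\<beta>] by auto
    with pisot(1) show False by simp
  qed
  define R where "R = {z. poly ch z = 0}"
  have "ch \<noteq> 0"
    using coeff_charpoly_card[of M] by (metis ch_def coeff_0 coeff_map_poly of_int_0 of_int_1 zero_neq_one)
  then have finR: "finite R" unfolding R_def by (rule poly_roots_finite)
  have "rsquarefree ch"
    unfolding rsquarefree_roots using is_min_poly_simple_roots[OF min] by (auto simp: ch)
  then have "smult (lead_coeff ch) (\<Prod>z\<in>R. [:-z, 1:]) = ch"
    unfolding R_def by (rule complex_poly_decompose_rsquarefree)
  then have "degree ch = degree (\<Prod>z\<in>R. [:-z, 1:])"
    using \<open>ch \<noteq> 0\<close> by (metis degree_smult_eq leading_coeff_0_iff)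
  then have "card R = degree ch"
    by (simp add: degree_prod_eq_sum_degree)
  moreover have "coeff ch CARD('n) = 1"
    by (simp add: ch_def coeff_map_poly coeff_charpoly_card)
  then have "CARD('n) \<le> degree ch" by (intro le_degree) simp
  ultimately have "CARD('n) \<le> card R" by simp
  \<comment> \<open>Indexing roots by the alphabet arranges the eigenvectors as the rows of a square
    matrix, so that independence of the rows gives invertibility.\<close>
  then obtain r :: "'n \<Rightarrow> complex" where r: "inj r" "range r \<subseteq> R"
    using card_le_inj[OF finite finR] by blast
  define P where "P z u \<longleftrightarrow>
      u \<noteq> 0 \<and> (\<forall>j. (\<Sum>i\<in>UNIV. u $ i * of_int (M $ i $ j)) = z * u $ j)"
    for z and u :: "complex ^ 'n"
  have "\<forall>z\<in>R. \<exists>u. P z u"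
    unfolding R_def ch_def left_eigenvector_iff P_def by simp
  then obtain w0 where "\<forall>z\<in>R. P z (w0 z)" by (rule bchoice[THEN exE])
  then have w0: "\<And>z. z \<in> R \<Longrightarrow> w0 z \<noteq> 0"
      "\<And>z j. z \<in> R \<Longrightarrow> (\<Sum>i\<in>UNIV. w0 z $ i * of_int (M $ i $ j)) = z * w0 z $ j"
    by (simp_all add: P_def)
  \<comment> \<open>At \<open>\<beta>\<close> the chosen eigenvector is replaced by \<open>v\<close>
    itself, so that this coordinate is exactly the inner product with \<open>v\<close>.\<close>
  define w where "w = w0(of_real \<beta> := vc)"
  have w: "\<And>z. z \<in> R \<Longrightarrow> w z \<noteq> 0"
      "\<And>z j. z \<in> R \<Longrightarrow> (\<Sum>i\<in>UNIV. w z $ i * of_int (M $ i $ j)) = z * w z $ j"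
    using w0 vcj \<open>vc \<noteq> 0\<close> by (auto simp: w_def)
  have coordM: "coord (w z) (M *v x) = z * coord (w z) x" if "z \<in> R" for z x
  proof -
    have "coord (w z) (M *v x) = (\<Sum>k\<in>UNIV. \<Sum>j\<in>UNIV. w z $ k * of_int (M $ k $ j) * of_int (x $ j))"
      by (simp add: coord_def matrix_vector_mult_def sum_distrib_left mult.assoc)
    also have "\<dots> = (\<Sum>j\<in>UNIV. (\<Sum>k\<in>UNIV. w z $ k * of_int (M $ k $ j)) * of_int (x $ j))"
      by (subst sum.swap) (simp add: sum_distrib_right)
    finally show ?thesis
      using w(2)[OF that] by (simp add: coord_def sum_distrib_left mult.assoc)
  qed
  have coordv: "coord (w (of_real \<beta>)) x = of_real (real_vec x \<bullet> v)" for x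
    by (simp add: w_def vc_def coord_def real_vec_def inner_vec_def mult.commute)
  define W :: "complex ^ 'n ^ 'n" where "W = (\<chi> i. w (r i))"
  have "\<exists>B. W ** B = mat 1"
    unfolding matrix_right_invertible_independent_rows
  proof (intro allI impI)
    fix c i assume 0: "(\<Sum>i\<in>UNIV. c i *s row i W) = 0"
    define Mc :: "complex ^ 'n ^ 'n" where "Mc = map_matrix of_int M"
    define u where "u z = c (inv r z) *s w z" for z
    have Mu: "w z v* Mc = z *s w z" if "z \<in> R" for z
      using w(2)[OF that] by (simp add: vec_eq_iff vector_matrix_mult_def Mc_def mult.commute)
    have "u (r i) = 0"
    proof (rule eigenvectors_independent[where T = "\<lambda>x. x v* Mc" and scale = "(*s)" and Z = "range r" and w = u])
      show "vector_space ((*s) :: complex \<Rightarrow> complex ^ 'n \<Rightarrow> _)"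
        by (rule vec.vector_space_axioms)
      show "u z v* Mc = z *s u z" if "z \<in> range r" for z
      proof -
        have "u z v* Mc = c (inv r z) *s (w z v* Mc)"
          by (simp add: u_def vec_eq_iff vector_matrix_mult_def sum_distrib_left algebra_simps)
        then show ?thesis
          using Mu[of z] that r(2) by (auto simp: u_def vec_eq_iff algebra_simps)
      qed
      have "(\<Sum>z\<in>range r. u z) = (\<Sum>i\<in>UNIV. c i *s w (r i))"
        by (subst sum.reindex) (use r in \<open>auto simp: u_def\<close>)
      also have "\<dots> = (\<Sum>i\<in>UNIV. c i *s row i W)"
        by (simp add: row_def W_def vec_lambda_eta)
      finally show "(\<Sum>z\<in>range r. u z) = 0" using 0 by simp
    qed (auto simp: vec_eq_iff vector_matrix_mult_def sum_distrib_left algebra_simps sum.distrib)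
    then show "c i = 0"
      using w(1)[of "r i"] r by (auto simp: u_def)
  qed
  then obtain B where "B ** W = mat 1" using matrix_left_right_inverse by blast
  define f where "f x = W *v (\<chi> k. complex_of_real (x $ k))" for x :: "real ^ 'n"
  have "linear f"
    by (rule linearI)
      (simp_all add: f_def vec_eq_iff matrix_vector_mult_def algebra_simps sum.distrib sum_distrib_left
        scaleR_conv_of_real[where 'a = complex])
  moreover have "inj f"
  proof (rule injI)
    fix x y assume "f x = f y"
    then have "(B ** W) *v (\<chi> k. complex_of_real (x $ k)) = (B ** W) *v (\<chi> k. complex_of_real (y $ k))"
      by (simp add: f_def flip: matrix_vector_mul_assoc)
    then show "x = y" using \<open>B ** W = mat 1\<close> by (simp add: vec_eq_iff)
  qed
  ultimately obtain D where D: "D > 0" "\<And>x. D * norm x \<le> norm (f x)"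
    using linear_inj_bounded_below_pos by blast
  have fr: "f (real_vec x) $ i = coord (w (r i)) x" for x i
    by (simp add: f_def W_def real_vec_def coord_def matrix_vector_mult_def)
  define Z where "Z = R - {of_real \<beta>}"
  show ?thesis
  proof (rule that[of \<beta> Z w])
    show "\<beta> > 1" using pisot(1) eq by simp
    show "finite Z" using finR by (simp add: Z_def)
    show "cmod z < 1" if "z \<in> Z" for z
      using that pisot(2)[of z] eq by (auto simp: Z_def R_def)
    show "coord (w z) (M *v x) = z * coord (w z) x" if "z \<in> Z" for z x
      using coordM that by (auto simp: Z_def)
    show "finite {x. \<bar>real_vec x \<bullet> v\<bar> \<le> b \<and> (\<forall>z\<in>Z. cmod (coord (w z) x) \<le> b)}" for b
    proof (rule finite_subset)
      show "{x. \<bar>real_vec x \<bullet> v\<bar> \<le> b \<and> (\<forall>z\<in>Z. cmod (coord (w z) x) \<le> b)}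
          \<subseteq> {x. \<forall>k. \<bar>x $ k\<bar> \<le> \<lceil>(of_nat CARD('n) * b) / D\<rceil>}"
      proof safe
        fix x k assume x: "\<bar>real_vec x \<bullet> v\<bar> \<le> b" "\<forall>z\<in>Z. cmod (coord (w z) x) \<le> b"
        have "cmod (coord (w (r i)) x) \<le> b" for i
          using x coordv[of x] r(2) by (cases "r i = of_real \<beta>") (auto simp: Z_def)
        then have "norm (f (real_vec x)) \<le> of_nat CARD('n) * b"
          unfolding norm_vec_def fr
          by (intro order_trans[OF L2_set_le_sum] sum_bounded_above) auto
        moreover have "D * \<bar>real_of_int (x $ k)\<bar> \<le> D * norm (real_vec x)"
          using D(1) component_le_norm_cart[of "real_vec x" k] by (simp add: real_vec_def)
        ultimately have "D * \<bar>real_of_int (x $ k)\<bar> \<le> of_nat CARD('n) * b"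
          using D(2)[of "real_vec x"] by linarith
        then have "\<bar>real_of_int (x $ k)\<bar> \<le> of_nat CARD('n) * b / D"
          using D(1) by (simp add: field_simps)
        then show "\<bar>x $ k\<bar> \<le> \<lceil>(of_nat CARD('n) * b) / D\<rceil>" by linarith
      qed
    qed (rule finite_int_vec_bounded)
  qed (use ev in simp)
qed

section \<open>Self-sustaining sets of nodes\<close>

definition arc_rel :: "('a \<times> 'l \<times> 'a) set \<Rightarrow> 'a \<Rightarrow> 'a \<Rightarrow> bool" where
  "arc_rel E a b \<longleftrightarrow> (\<exists>\<eta>. (a, \<eta>, b) \<in> E)"

definition sustaining :: "('a \<Rightarrow> 'a \<Rightarrow> bool) \<Rightarrow> 'a set \<Rightarrow> bool" where
  "sustaining R S \<longleftrightarrow> (\<forall>a\<in>S. \<exists>b\<in>S. R a b)"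

definition sustained_core :: "('a \<Rightarrow> 'a \<Rightarrow> bool) \<Rightarrow> 'a set \<Rightarrow> 'a set" where
  "sustained_core R V = \<Union>{S. S \<subseteq> V \<and> sustaining R S}"

text \<open>This captures the nodes with a walk into a cycle. The ambient graph may be infinite, so
  a self-sustaining set alone allows walks that never return; finiteness forces a
  repetition.\<close>

definition finite_core :: "('a \<Rightarrow> 'a \<Rightarrow> bool) \<Rightarrow> 'a set \<Rightarrow> 'a set" where
  "finite_core R V = \<Union>{S. S \<subseteq> V \<and> finite S \<and> sustaining R S}"

lemma sustaining_Union: "(\<And>S. S \<in> F \<Longrightarrow> sustaining R S) \<Longrightarrow> sustaining R (\<Union>F)"
  unfolding sustaining_def by (meson UnionE UnionI)

lemma sustaining_core: "sustaining R (sustained_core R V)" "sustained_core R V \<subseteq> V"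
  unfolding sustained_core_def by (rule sustaining_Union) auto

lemma core_maximal: "S \<subseteq> V \<Longrightarrow> sustaining R S \<Longrightarrow> S \<subseteq> sustained_core R V"
  unfolding sustained_core_def by blast

lemma sustaining_finite_core: "sustaining R (finite_core R V)" "finite_core R V \<subseteq> V"
  unfolding finite_core_def by (rule sustaining_Union) auto

lemma finite_core_maximal: "S \<subseteq> V \<Longrightarrow> finite S \<Longrightarrow> sustaining R S \<Longrightarrow> S \<subseteq> finite_core R V"
  unfolding finite_core_def by blast

lemma finite_coreE:
  assumes "n \<in> finite_core R V"
  obtains S where "n \<in> S" "S \<subseteq> V" "finite S" "sustaining R S"
  using assms unfolding finite_core_def by blast

lemma sustainingD: "sustaining R S \<Longrightarrow> a \<in> S \<Longrightarrow> \<exists>b\<in>S. R a b"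
  by (simp add: sustaining_def)

text \<open>The first repetition is taken: distinctness before \<open>j\<close> is what turns the
  segment from \<open>i\<close> to \<open>j\<close> into a cycle in the strict sense.\<close>

lemma pigeonhole_seq:
  fixes a :: "nat \<Rightarrow> 'a"
  assumes "finite X" and "\<And>k. k \<le> card X \<Longrightarrow> a k \<in> X"
  obtains i j where "i < j" "j \<le> card X" "a i = a j" "inj_on a {..<j}"
proof -
  have "\<not> inj_on a {..card X}"
  proof
    assume "inj_on a {..card X}"
    moreover have "a ` {..card X} \<subseteq> X" using assms(2) by auto
    ultimately have "card {..card X} \<le> card X" using assms(1) by (metis card_inj_on_le)
    then show False by simp
  qed
  then have ex: "\<exists>j. j \<le> card X \<and> (\<exists>i<j. a i = a j)"
    by (auto simp: inj_on_def) (metis linorder_neqE_nat)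
  define j where "j = (LEAST j. j \<le> card X \<and> (\<exists>i<j. a i = a j))"
  have j: "j \<le> card X" "\<exists>i<j. a i = a j"
    using LeastI_ex[OF ex] by (auto simp: j_def)
  have "inj_on a {..<j}"
  proof (rule inj_onI, rule ccontr)
    fix x y assume *: "x \<in> {..<j}" "y \<in> {..<j}" "a x = a y" "x \<noteq> y"
    have False if "x < y" "y < j" "a x = a y" for x y
      using not_less_Least[of y "\<lambda>j. j \<le> card X \<and> (\<exists>i<j. a i = a j)"] that j(1)
      unfolding j_def[symmetric] by fastforce
    with * show False by (metis lessThan_iff linorder_neqE_nat)
  qed
  with j that show ?thesis by blast
qed

text \<open>The walk repeats a node, and its part up to the first repetition sustains itself. This
  is how a walk of bounded length certifies membership in a reduced graph.\<close>

lemma long_walk_in_core: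
  assumes "finite X" and N: "card X \<le> N"
    and "\<And>k. k \<le> N \<Longrightarrow> a k \<in> X" and R: "\<And>k. k < N \<Longrightarrow> R (a k) (a (Suc k))"
  shows "a 0 \<in> sustained_core R X"
proof -
  have "a k \<in> X" if "k \<le> card X" for k using assms(3) that N by simp
  then obtain i j where ij: "i < j" "j \<le> card X" "a i = a j"
    by (rule pigeonhole_seq[OF \<open>finite X\<close>, of a])
  have "sustaining R (a ` {..<j})"
    unfolding sustaining_def
  proof (intro ballI)
    fix x assume "x \<in> a ` {..<j}"
    then obtain k where k: "k < j" "x = a k" by auto
    then have "R x (a (Suc k))" using R ij N by simp
    moreover have "a (Suc k) \<in> a ` {..<j}"
    proof (cases "Suc k = j")
      case True
      then show ?thesis using ij by (metis imageI lessThan_iff)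
    qed (use k in auto)
    ultimately show "\<exists>b\<in>a ` {..<j}. R x b" by blast
  qed
  moreover have "a ` {..<j} \<subseteq> X" using assms(3) ij N by auto
  ultimately have "a ` {..<j} \<subseteq> sustained_core R X" by (rule core_maximal[rotated])
  then show ?thesis using ij by auto
qed

lemma sustaining_walk:
  assumes "sustaining R S" "n \<in> S"
  obtains a where "a 0 = n" "\<And>k. a k \<in> S" "\<And>k. R (a k) (a (Suc k))"
proof -
  obtain f where f: "\<And>x. x \<in> S \<Longrightarrow> f x \<in> S \<and> R x (f x)"
    using assms(1) unfolding sustaining_def by metis
  define a where "a k = (f ^^ k) n" for k
  have "a k \<in> S" for k by (induction k) (use assms f in \<open>auto simp: a_def\<close>)
  moreover from this have "R (a k) (a (Suc k))" for k using f by (simp add: a_def)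
  ultimately show ?thesis using that[of a] by (simp add: a_def)
qed


section \<open>Reductions of edge graphs\<close>

lemma edge_graph_simps [simp]:
  "verts (edge_graph V E) = V" "arcs (edge_graph V E) = {(n, \<eta>, n') \<in> E. n \<in> V \<and> n' \<in> V}"
  "tail (edge_graph V E) = (\<lambda>(n, \<eta>, n'). n)" "head (edge_graph V E) = (\<lambda>(n, \<eta>, n'). n')"
  by (simp_all add: edge_graph_def)

lemma edge_graph_eq_iff: "edge_graph V E = edge_graph W E \<longleftrightarrow> V = W"
  by (metis edge_graph_simps(1))

lemma edge_graph_induce: "X \<subseteq> V \<Longrightarrow> edge_graph V E \<restriction> X = edge_graph X E"
  by (auto simp: induce_subgraph_def edge_graph_def)

lemma subgraph_edge_graph: "X \<subseteq> V \<Longrightarrow> subgraph (edge_graph X E) (edge_graph V E)"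
  using wf_edge_graph by (auto simp: subgraph_def compatible_def)

lemma subgraph_edge_graphI:
  assumes "subgraph K (edge_graph V E)" "verts K \<subseteq> X"
  shows "subgraph K (edge_graph X E)"
proof -
  have K: "wf_digraph K" "tail K = (\<lambda>(n, \<eta>, n'). n)" "head K = (\<lambda>(n, \<eta>, n'). n')"
    "arcs K \<subseteq> arcs (edge_graph V E)"
    using assms(1) by (auto simp: subgraph_def compatible_def)
  have "n \<in> X \<and> n' \<in> X" if "(n, \<eta>, n') \<in> arcs K" for n \<eta> n'
    using wf_digraph.wellformed[OF K(1) that] K(2,3) assms(2) by auto
  then show ?thesis
    using K assms(2) wf_edge_graph unfolding subgraph_def compatible_def by fastforce
qed

lemma out_arcs_edge_graph:
  "out_arcs (edge_graph V E) n \<noteq> {} \<longleftrightarrow> n \<in> V \<and> (\<exists>m\<in>V. arc_rel E n m)"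
proof
  assume "n \<in> V \<and> (\<exists>m\<in>V. arc_rel E n m)"
  then obtain m \<eta> where "n \<in> V" "m \<in> V" "(n, \<eta>, m) \<in> E" by (auto simp: arc_rel_def)
  then have "(n, \<eta>, m) \<in> out_arcs (edge_graph V E) n" by (simp add: out_arcs_def)
  then show "out_arcs (edge_graph V E) n \<noteq> {}" by blast
qed (auto simp: out_arcs_def arc_rel_def)

lemma subgraph_edge_graph_arcD:
  assumes "subgraph K (edge_graph V E)" "e \<in> arcs K"
  shows "arc_rel E (tail K e) (head K e)" "head K e \<in> verts K"
proof -
  have K: "tail K = (\<lambda>(n, \<eta>, n'). n)" "head K = (\<lambda>(n, \<eta>, n'). n')" "wf_digraph K"
    "arcs K \<subseteq> arcs (edge_graph V E)"
    using assms(1) by (auto simp: subgraph_def compatible_def)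
  have "e \<in> E" "tail K e = fst e" "head K e = snd (snd e)"
    using K(4) assms(2) by (auto simp: K(1,2) split_beta)
  with K(3)
  show "arc_rel E (tail K e) (head K e)" "head K e \<in> verts K"
    using assms(2) wf_digraph.head_in_verts[of K e] unfolding arc_rel_def
    by (metis prod.collapse, metis)
qed

text \<open>A subgraph without sinks need not be induced, but its node set is self-sustaining, and
  adding all edges between these nodes creates no sink. Hence the largest one is induced by the
  core.\<close>

lemma Red_edge_graph: "Red (edge_graph V E) = edge_graph (sustained_core (arc_rel E) V) E"
  unfolding Red_def
proof (rule largest_subgraph_equality)
  let ?C = "sustained_core (arc_rel E) V"
  show "subgraph (edge_graph ?C E) (edge_graph V E)"
    by (rule subgraph_edge_graph) (rule sustaining_core)
  show "no_sinks (edge_graph ?C E)"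
    using sustaining_core(1)[of "arc_rel E" V]
    by (auto simp: no_sinks_def sustaining_def out_arcs_edge_graph simp del: edge_graph_simps(2-))
  fix K assume K: "subgraph K (edge_graph V E)" "no_sinks K"
  show "subgraph K (edge_graph ?C E)"
  proof (rule subgraph_edge_graphI[OF K(1)], rule core_maximal)
    show "verts K \<subseteq> V" using K(1) by (auto simp: subgraph_def)
    show "sustaining (arc_rel E) (verts K)"
      unfolding sustaining_def
    proof
      fix n assume "n \<in> verts K"
      then obtain e where "e \<in> arcs K" "tail K e = n"
        using K(2) by (auto simp: no_sinks_def out_arcs_def)
      then show "\<exists>b\<in>verts K. arc_rel E n b"
        using subgraph_edge_graph_arcD[OF K(1)] by blast
    qed
  qed
qed

section \<open>Walks that end in a cycle\<close>

lemma awalk_of_seq: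
  assumes "m \<le> n" "\<And>k. m \<le> k \<Longrightarrow> k \<le> n \<Longrightarrow> a k \<in> V"
    "\<And>k. m \<le> k \<Longrightarrow> k < n \<Longrightarrow> (a k, \<eta> k, a (Suc k)) \<in> E"
  shows "pre_digraph.awalk (edge_graph V E) (a m) (map (\<lambda>k. (a k, \<eta> k, a (Suc k))) [m..<n]) (a n)"
    and "pre_digraph.awalk_verts (edge_graph V E) (a m) (map (\<lambda>k. (a k, \<eta> k, a (Suc k))) [m..<n]) =
      map a [m..<Suc n]"
  using assms
proof (induction "n - m" arbitrary: m)
  case 0
  { case 1 then show ?case using 0 by (simp add: pre_digraph.awalk_def pre_digraph.cas.simps) }
  { case 2 then show ?case using 0 by (simp add: pre_digraph.awalk_verts.simps) }
next
  case (Suc d)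
  { case 1
    then have "m < n" using Suc by simp
    then show ?case
      using Suc(1)[of "Suc m"] Suc(3) 1
      by (auto simp: pre_digraph.awalk_def pre_digraph.cas.simps upt_conv_Cons) }
  { case 2
    then have "m < n" using Suc by simp
    then show ?case
      using Suc(2)[of "Suc m"] Suc(3) 2
      by (auto simp: pre_digraph.awalk_verts.simps upt_conv_Cons simp del: upt_Suc) }
qed

text \<open>Only the final node could lack a successor on the walk, and it is also the start of the
  nonempty closing cycle \<open>q\<close>.\<close>

lemma awalk_verts_sustaining:
  assumes "wf_digraph G" and w: "pre_digraph.awalk G u (p @ q) w" and "pre_digraph.cycle G q"
    and "a \<in> set (pre_digraph.awalk_verts G u (p @ q))"
  shows "\<exists>e\<in>arcs G. tail G e = a \<and> head G e \<in> set (pre_digraph.awalk_verts G u (p @ q))"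
proof -
  interpret wf_digraph G by fact
  have "a = w \<or> (\<exists>e\<in>set r. tail G e = a)" if "cas x r w" "a \<in> set (awalk_verts x r)" for x r
    using that by (induction r arbitrary: x) auto
  then have "a = w \<or> (\<exists>e\<in>set (p @ q). tail G e = a)"
    using w assms(4) unfolding awalk_def by blast
  moreover have "\<exists>e\<in>set (p @ q). tail G e = w"
  proof -
    obtain x where x: "awalk x q x" "q \<noteq> []"
      using \<open>cycle q\<close> by (auto simp: cycle_def)
    obtain y where "awalk y q w" using w by auto
    then have "x = w" using x
      by (metis awalk_ends)
    then show ?thesis using x by (cases q) (auto simp: awalk_def)
  qed
  ultimately obtain e where "e \<in> set (p @ q)" "tail G e = a" by blast
  then show ?thesis
    using w awalk_verts_arc2[OF w] by (auto simp: awalk_def)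
qed

text \<open>The nodes of a walk ending in a cycle form a finite self-sustaining set. Conversely, an
  infinite walk inside such a set must repeat a node, and its first repetition closes a
  cycle.\<close>

lemma loop_part_edge_graph: "loop_part (edge_graph V E) = edge_graph (finite_core (arc_rel E) V) E"
  unfolding loop_part_def
proof (rule largest_subgraph_equality)
  let ?C = "finite_core (arc_rel E) V"
  let ?H = "edge_graph ?C E"
  show "subgraph ?H (edge_graph V E)"
    by (rule subgraph_edge_graph) (rule sustaining_finite_core)
  show "all_nodes_to_loop ?H"
    unfolding all_nodes_to_loop_def
  proof
    fix n assume "n \<in> verts ?H"
    then obtain S where S: "n \<in> S" "S \<subseteq> V" "finite S" "sustaining (arc_rel E) S"
      by (auto simp: finite_core_def)
    obtain a where a: "a 0 = n" "\<And>k. a k \<in> S" "\<And>k. arc_rel E (a k) (a (Suc k))"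
      using sustaining_walk[OF S(4,1)] by blast
    obtain \<eta> where \<eta>: "\<And>k. (a k, \<eta> k, a (Suc k)) \<in> E"
      using a(3) unfolding arc_rel_def by metis
    obtain i j where ij: "i < j" "a i = a j" "inj_on a {..<j}"
      by (rule pigeonhole_seq[OF S(3), of a]) (use a(2) in auto)
    have aC: "a k \<in> ?C" for k
      using finite_core_maximal[OF S(2-4)] a(2) by blast
    let ?w = "\<lambda>m n. map (\<lambda>k. (a k, \<eta> k, a (Suc k))) [m..<n]"
    have "[0..<j] = [0..<i] @ [i..<j]" using ij(1) by (metis le_add_diff_inverse less_imp_le upt_add_eq_append zero_le)
    then have split: "?w 0 i @ ?w i j = ?w 0 j" by (simp flip: map_append)
    note walk = awalk_of_seq[where a = a and \<eta> = \<eta> and V = ?C and E = E, OF _ aC \<eta>]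
    have "pre_digraph.cycle ?H (?w i j)"
      unfolding pre_digraph.cycle_def
    proof (intro exI[of _ "a i"] conjI)
      show "pre_digraph.awalk ?H (a i) (?w i j) (a i)"
        using walk(1)[of i j] ij(1,2) by simp
      have tl: "tl [i..<Suc j] = [Suc i..<Suc j]" using ij(1) by (subst upt_conv_Cons) auto
      \<comment> \<open>The node list of a closed walk repeats its end point, so distinctness is
        required only of the tail. Since \<open>a i = a j\<close>, replacing index \<open>j\<close>
        by \<open>i\<close> reduces the claim to the injectivity below \<open>j\<close>.\<close>
      have "inj_on a {Suc i..<Suc j}"
      proof (rule inj_onI)
        fix x y assume "x \<in> {Suc i..<Suc j}" "y \<in> {Suc i..<Suc j}" "a x = a y"
        moreover define r where "r x = (if x = j then i else x)" for x
        ultimately have "a (r x) = a (r y)" "r x < j" "r y < j" "x = j \<or> x > i" "y = j \<or> y > i"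
          using ij by auto
        moreover from this have "r x = r y" using ij(3) by (auto dest: inj_onD)
        ultimately show "x = y" by (auto simp: r_def split: if_splits)
      qed
      then show "distinct (tl (pre_digraph.awalk_verts ?H (a i) (?w i j)))"
        using walk(2)[of i j] ij(1) by (simp add: map_tl[symmetric] tl distinct_map del: upt_Suc)
      show "?w i j \<noteq> []" using ij(1) by simp
    qed
    moreover have "pre_digraph.awalk ?H n (?w 0 i @ ?w i j) (a j)"
      unfolding split using walk(1)[of 0 j] a(1) by simp
    moreover have "n \<in> set (pre_digraph.awalk_verts ?H n (?w 0 i @ ?w i j))"
      unfolding split using walk(2)[of 0 j] a(1) by (auto simp: image_iff simp del: upt_Suc)
    ultimately show "\<exists>u p q w. pre_digraph.awalk ?H u (p @ q) w \<and> pre_digraph.cycle ?H q \<and>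
        n \<in> set (pre_digraph.awalk_verts ?H u (p @ q))"
      by blast
  qed
  fix K assume K: "subgraph K (edge_graph V E)" "all_nodes_to_loop K"
  show "subgraph K ?H"
  proof (rule subgraph_edge_graphI[OF K(1)], rule subsetI)
    fix n assume "n \<in> verts K"
    then obtain u p q w where w: "pre_digraph.awalk K u (p @ q) w" "pre_digraph.cycle K q"
        "n \<in> set (pre_digraph.awalk_verts K u (p @ q))"
      using K(2) unfolding all_nodes_to_loop_def by blast
    have wf: "wf_digraph K" using K(1) by (simp add: subgraph_def)
    let ?S = "set (pre_digraph.awalk_verts K u (p @ q))"
    have "sustaining (arc_rel E) ?S"
      unfolding sustaining_def
    proof
      fix a assume "a \<in> ?S"
      from awalk_verts_sustaining[OF wf w(1,2) this]
      show "\<exists>b\<in>?S. arc_rel E a b"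
        using subgraph_edge_graph_arcD(1)[OF K(1)] by metis
    qed
    moreover have "?S \<subseteq> verts K"
      using wf_digraph.awalk_verts_in_verts[OF wf, of u "p @ q"] w(1) by (auto simp: pre_digraph.awalk_def)
    then have "?S \<subseteq> V" using K(1) by (auto simp: subgraph_def)
    ultimately show "n \<in> finite_core (arc_rel E) V"
      using finite_core_maximal[of ?S V "arc_rel E"] w(3) by blast
  qed
qed

lemma reachable_edge_graph_induct [consumes 1, case_names base step]:
  assumes "reachable (edge_graph V E) n m"
    and "m \<in> V \<Longrightarrow> P m"
    and "\<And>a b. a \<in> V \<Longrightarrow> b \<in> V \<Longrightarrow> arc_rel E a b \<Longrightarrow> reachable (edge_graph V E) b m \<Longrightarrow> P b \<Longrightarrow> P a"
  shows "P n"
  using assms(1) unfolding reachable_def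
proof (induction rule: converse_rtrancl_on_induct)
  case base
  then show ?case using assms(2) by simp
next
  case (step a b)
  have "b \<in> V" using step.hyps(1) by (auto simp: arcs_ends_def arc_to_ends_def)
  with step show ?case
    by (intro assms(3)[of a b])
      (auto simp: arcs_ends_def arc_to_ends_def arc_rel_def reachable_def)
qed

lemma reachable_edge_graph_refl: "m \<in> V \<Longrightarrow> reachable (edge_graph V E) m m"
  by (simp add: reachable_def)

lemma reachable_edge_graph_step:
  assumes "a \<in> V" "b \<in> V" "arc_rel E a b" "reachable (edge_graph V E) b m"
  shows "reachable (edge_graph V E) a m"
proof -
  have "(a, b) \<in> arcs_ends (edge_graph V E)"
    using assms by (force simp: arcs_ends_def arc_to_ends_def arc_rel_def)
  then show ?thesis
    using assms converse_rtrancl_on_into_rtrancl_on[of a b] by (simp add: reachable_def)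
qed

section \<open>Ambient and simple ambient edges\<close>

lemma simple_rel_iff:
  "arc_rel (simple_ambient_edges \<sigma>) (i, x, j) (i', x', j') \<longleftrightarrow>
    (\<exists>p s q t. \<sigma> i' = p @ [i] @ s \<and> \<sigma> j' = q @ [j] @ t \<and>
       incidence \<sigma> *v x' = x + abel q - abel p)"
proof
  assume "\<exists>p s q t. \<sigma> i' = p @ [i] @ s \<and> \<sigma> j' = q @ [j] @ t \<and>
       incidence \<sigma> *v x' = x + abel q - abel p"
  then obtain p s q t where "\<sigma> i' = p @ [i] @ s" "\<sigma> j' = q @ [j] @ t"
       "incidence \<sigma> *v x' = x + abel q - abel p"
    by blast
  then have "((i, x, j), (abel p, abel q), (i', x', j')) \<in> simple_ambient_edges \<sigma>"
    unfolding simple_ambient_edges_def factorizations_def by blast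
  then show "arc_rel (simple_ambient_edges \<sigma>) (i, x, j) (i', x', j')"
    unfolding arc_rel_def by blast
qed (auto simp: arc_rel_def simple_ambient_edges_def)

lemma ambient_rel_iff:
  "arc_rel (ambient_edges \<sigma> v) (i, x, j) (i', x', j') \<longleftrightarrow>
    (\<exists>p s q t. \<sigma> i' = p @ [i] @ s \<and> \<sigma> j' = q @ [j] @ t \<and>
        incidence \<sigma> *v x' = x + abel q - abel p
      \<or> \<sigma> j' = p @ [i] @ s \<and> \<sigma> i' = q @ [j] @ t \<and>
        - (incidence \<sigma> *v x') = x + abel q - abel p)"
  unfolding arc_rel_def ambient_edges_def factorizations_def
  by (simp del: append_Cons) blast

lemma real_vec_inner_simps:
  "real_vec (x + y) \<bullet> v = real_vec x \<bullet> v + real_vec y \<bullet> v"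
  "real_vec (x - y) \<bullet> v = real_vec x \<bullet> v - real_vec y \<bullet> v"
  "real_vec (- x) \<bullet> v = - (real_vec x \<bullet> v)"
  "real_vec 0 \<bullet> v = 0"
  "real_vec (axis j 1) \<bullet> v = v $ j"
proof -
  have "real_vec (axis j 1) = axis j 1" by (auto simp: real_vec_def axis_def vec_eq_iff)
  then show "real_vec (axis j 1) \<bullet> v = v $ j" by (simp add: inner_axis')
qed (simp_all add: real_vec_def inner_vec_def sum_negf sum.distrib sum_subtractf algebra_simps)

lemma neg_node_simp [simp]: "neg_node (i, x, j) = (j, - x, i)"
  by (simp add: neg_node_def)

lemma neg_neg_node [simp]: "neg_node (neg_node n) = n"
  by (cases n) simp

lemma mem_pm: "n \<in> pm K \<longleftrightarrow> n \<in> K \<or> neg_node n \<in> K"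
  unfolding pm_def by (metis UnCI UnE imageE imageI neg_neg_node)

lemma neg_mem_pm [simp]: "neg_node n \<in> pm K \<longleftrightarrow> n \<in> pm K"
  by (auto simp: mem_pm)

lemma finite_pm: "finite K \<Longrightarrow> finite (pm K)"
  by (simp add: pm_def)

lemma matrix_vector_mult_uminus: "A *v (- x) = - (A *v (x :: int ^ 'n))"
  by (simp add: vec_eq_iff matrix_vector_mult_def sum_negf)

lemma simple_rel_neg_aux:
  "arc_rel (simple_ambient_edges \<sigma>) a b \<Longrightarrow> arc_rel (simple_ambient_edges \<sigma>) (neg_node a) (neg_node b)"
proof -
  assume ab: "arc_rel (simple_ambient_edges \<sigma>) a b"
  obtain i x j i' x' j' where [simp]: "a = (i, x, j)" "b = (i', x', j')" by (cases a, cases b) auto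
  from ab obtain p s q t where e: "\<sigma> i' = p @ [i] @ s" "\<sigma> j' = q @ [j] @ t"
      "incidence \<sigma> *v x' = x + abel q - abel p"
    by (auto simp: simple_rel_iff)
  then have "incidence \<sigma> *v (- x') = - x + abel p - abel q"
    by (simp add: matrix_vector_mult_uminus)
  then show ?thesis using e by (auto simp: simple_rel_iff)
qed

lemma simple_rel_neg:
  "arc_rel (simple_ambient_edges \<sigma>) (neg_node a) (neg_node b) \<longleftrightarrow> arc_rel (simple_ambient_edges \<sigma>) a b"
  using simple_rel_neg_aux[of \<sigma> a b] simple_rel_neg_aux[of \<sigma> "neg_node a" "neg_node b"] by auto

text \<open>A type 2 edge is a simple edge to the negated target, as -Mx' = M(-x'). Labels drop out
  because every admissible pair of factorizations receives one. The ambient graph thus appears as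
  the simple one modulo sign.\<close>

lemma ambient_rel_eq:
  "arc_rel (ambient_edges \<sigma> v) a b \<longleftrightarrow>
     arc_rel (simple_ambient_edges \<sigma>) a b \<or> arc_rel (simple_ambient_edges \<sigma>) a (neg_node b)"
proof -
  obtain i x j i' x' j' where [simp]: "a = (i, x, j)" "b = (i', x', j')" by (cases a, cases b) auto
  show ?thesis
    unfolding \<open>a = _\<close> \<open>b = _\<close> neg_node_simp ambient_rel_iff simple_rel_iff matrix_vector_mult_uminus
    by blast
qed

lemma mem_simple_ambient_nodes:
  assumes "\<And>i. v $ i > 0"
  shows "(i, x, j) \<in> simple_ambient_nodes v \<longleftrightarrow>
    - v $ i < real_vec x \<bullet> v \<and> real_vec x \<bullet> v < v $ j \<and> (i, x, j) \<notin> trivial_nodes"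
proof -
  have "real_vec (- x) \<bullet> v = - (real_vec x \<bullet> v)"
    by (simp add: real_vec_def inner_vec_def sum_negf)
  then show ?thesis
    using assms[of i] assms[of j]
    by (auto simp: simple_ambient_nodes_def mem_pm surface_nodes_def stepped_surface_def inner_axis')
qed

lemma simple_ambient_nodes_neg:
  "neg_node n \<in> simple_ambient_nodes v \<longleftrightarrow> n \<in> simple_ambient_nodes v"
proof -
  have "neg_node n \<in> trivial_nodes \<longleftrightarrow> n \<in> trivial_nodes"
    by (cases n) (auto simp: trivial_nodes_def)
  then show ?thesis by (simp add: simple_ambient_nodes_def)
qed

lemma ambient_subset_simple: "ambient_nodes v \<subseteq> simple_ambient_nodes v"
  by (auto simp: ambient_nodes_def simple_ambient_nodes_def mem_pm trivial_nodes_def)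

lemma simple_ambient_cases:
  assumes "\<And>i. v $ i > 0" and "n \<in> simple_ambient_nodes v"
  shows "n \<in> ambient_nodes v \<or> neg_node n \<in> ambient_nodes v"
  using assms
  by (cases n) (auto simp: ambient_nodes_def simple_ambient_nodes_def mem_pm trivial_nodes_def
      surface_nodes_def stepped_surface_def real_vec_inner_simps inner_axis')

lemma sustaining_simple_imp_ambient:
  assumes pos: "\<And>i. v $ i > 0" and "sustaining (arc_rel (simple_ambient_edges \<sigma>)) S" "S \<subseteq> simple_ambient_nodes v"
  shows "sustaining (arc_rel (ambient_edges \<sigma> v)) (pm S \<inter> ambient_nodes v)"
  unfolding sustaining_def
proof
  fix a assume a: "a \<in> pm S \<inter> ambient_nodes v"
  have "\<exists>b\<in>pm S. arc_rel (simple_ambient_edges \<sigma>) a b"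
  proof (cases "a \<in> S")
    case True
    then show ?thesis using assms(2) unfolding sustaining_def by (meson mem_pm)
  next
    case False
    then have "neg_node a \<in> S" using a by (simp add: mem_pm)
    then obtain b where "b \<in> S" "arc_rel (simple_ambient_edges \<sigma>) (neg_node a) b"
      using assms(2) unfolding sustaining_def by blast
    then show ?thesis
      using simple_rel_neg[of \<sigma> a "neg_node b"] by (intro bexI[of _ "neg_node b"]) (auto simp: mem_pm)
  qed
  then obtain b where b: "b \<in> pm S" "arc_rel (simple_ambient_edges \<sigma>) a b" by blast
  have "b \<in> simple_ambient_nodes v"
    using b(1) assms(3) simple_ambient_nodes_neg[of b v] by (auto simp: mem_pm)
  then have "b \<in> ambient_nodes v \<or> neg_node b \<in> ambient_nodes v"
    by (rule simple_ambient_cases[OF pos])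
  then show "\<exists>b\<in>pm S \<inter> ambient_nodes v. arc_rel (ambient_edges \<sigma> v) a b"
  proof
    assume "b \<in> ambient_nodes v"
    then show ?thesis using b by (auto simp: ambient_rel_eq)
  next
    assume "neg_node b \<in> ambient_nodes v"
    then show ?thesis using b by (intro bexI[of _ "neg_node b"]) (auto simp: ambient_rel_eq)
  qed
qed

text \<open>Closing a set under negation leads from the ambient to the simple graph, and keeping the
  ambient representatives leads back. Both operations preserve finiteness and successors, since
  simple edges are invariant under negation.\<close>

lemma finite_core_ambient:
  assumes pos: "\<And>i. v $ i > 0"
  shows "finite_core (arc_rel (ambient_edges \<sigma> v)) (ambient_nodes v) =
     finite_core (arc_rel (simple_ambient_edges \<sigma>)) (simple_ambient_nodes v) \<inter> ambient_nodes v"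
proof (intro equalityI subsetI)
  fix n assume "n \<in> finite_core (arc_rel (ambient_edges \<sigma> v)) (ambient_nodes v)"
  then obtain S where S: "n \<in> S" "S \<subseteq> ambient_nodes v" "finite S"
      "sustaining (arc_rel (ambient_edges \<sigma> v)) S"
    by (rule finite_coreE)
  have "sustaining (arc_rel (simple_ambient_edges \<sigma>)) (pm S)"
    unfolding sustaining_def
  proof
    fix a assume "a \<in> pm S"
    moreover have step: "\<exists>b\<in>pm S. arc_rel (simple_ambient_edges \<sigma>) a b" if aS: "a \<in> S" for a
    proof -
      obtain b where "b \<in> S" "arc_rel (ambient_edges \<sigma> v) a b"
        using sustainingD[OF S(4) aS] by blast
      moreover from this have "b \<in> pm S" "neg_node b \<in> pm S" by (simp_all add: mem_pm)
      ultimately show ?thesis unfolding ambient_rel_eq by blast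
    qed
    moreover have "\<exists>b\<in>pm S. arc_rel (simple_ambient_edges \<sigma>) a b" if na: "neg_node a \<in> S"
    proof -
      obtain b where b: "b \<in> pm S" "arc_rel (simple_ambient_edges \<sigma>) (neg_node a) b"
        using step[OF na] by blast
      then have "neg_node b \<in> pm S" "arc_rel (simple_ambient_edges \<sigma>) a (neg_node b)"
        using simple_rel_neg[of \<sigma> a "neg_node b"] by simp_all
      then show ?thesis by blast
    qed
    ultimately show "\<exists>b\<in>pm S. arc_rel (simple_ambient_edges \<sigma>) a b"
      using step[of a] unfolding mem_pm by blast
  qed
  moreover have "pm S \<subseteq> simple_ambient_nodes v"
  proof
    fix a assume "a \<in> pm S"
    then have "a \<in> simple_ambient_nodes v \<or> neg_node a \<in> simple_ambient_nodes v"
      using S(2) ambient_subset_simple by (auto simp: mem_pm)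
    then show "a \<in> simple_ambient_nodes v" by (simp add: simple_ambient_nodes_neg)
  qed
  ultimately have "pm S \<subseteq> finite_core (arc_rel (simple_ambient_edges \<sigma>)) (simple_ambient_nodes v)"
    using S(3) by (intro finite_core_maximal finite_pm)
  then show "n \<in> finite_core (arc_rel (simple_ambient_edges \<sigma>)) (simple_ambient_nodes v) \<inter> ambient_nodes v"
    using S(1,2) by (auto simp: mem_pm)
next
  fix n assume "n \<in> finite_core (arc_rel (simple_ambient_edges \<sigma>)) (simple_ambient_nodes v) \<inter> ambient_nodes v"
  then have n: "n \<in> ambient_nodes v"
      "n \<in> finite_core (arc_rel (simple_ambient_edges \<sigma>)) (simple_ambient_nodes v)"
    by blast+
  from n(2) obtain S where S: "n \<in> S" "S \<subseteq> simple_ambient_nodes v" "finite S"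
      "sustaining (arc_rel (simple_ambient_edges \<sigma>)) S"
    by (rule finite_coreE)
  have "pm S \<inter> ambient_nodes v \<subseteq> finite_core (arc_rel (ambient_edges \<sigma> v)) (ambient_nodes v)"
  proof (rule finite_core_maximal)
    show "sustaining (arc_rel (ambient_edges \<sigma> v)) (pm S \<inter> ambient_nodes v)"
      using pos S by (intro sustaining_simple_imp_ambient)
  qed (use finite_pm[OF S(3)] in auto)
  then show "n \<in> finite_core (arc_rel (ambient_edges \<sigma> v)) (ambient_nodes v)"
    using S(1) n(1) by (auto simp: mem_pm)
qed


section \<open>Adjacent faces\<close>

lemma unit_cube_iff:
  "u \<in> unit_cube a S \<longleftrightarrow> (\<forall>k. if k \<in> S then a $ k \<le> u $ k \<and> u $ k \<le> a $ k + 1 else u $ k = a $ k)"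
proof -
  have comp: "(\<Sum>j\<in>S. \<theta> j *\<^sub>R axis j 1 :: real ^ 'a) $ k = (if k \<in> S then \<theta> k else 0)" for \<theta> :: "'a \<Rightarrow> real" and k
    by (simp add: sum_component axis_def if_distrib cong: if_cong)
  show ?thesis
  proof
    assume "u \<in> unit_cube a S"
    then show "\<forall>k. if k \<in> S then a $ k \<le> u $ k \<and> u $ k \<le> a $ k + 1 else u $ k = a $ k"
      unfolding unit_cube_def by (auto simp: comp simp del: sum_component)
  next
    assume u: "\<forall>k. if k \<in> S then a $ k \<le> u $ k \<and> u $ k \<le> a $ k + 1 else u $ k = a $ k"
    have "u = a + (\<Sum>j\<in>S. (u $ j - a $ j) *\<^sub>R axis j 1)"
      using u by (auto simp: vec_eq_iff comp simp del: sum_component split: if_splits)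
    moreover have "\<forall>j\<in>S. 0 \<le> u $ j - a $ j \<and> u $ j - a $ j \<le> 1"
    proof
      fix j assume "j \<in> S"
      then show "0 \<le> u $ j - a $ j \<and> u $ j - a $ j \<le> 1"
        using u[rule_format, of j] by simp
    qed
    ultimately show "u \<in> unit_cube a S"
      unfolding unit_cube_def by (intro CollectI exI[of _ "\<lambda>j. u $ j - a $ j"] conjI)
  qed
qed

lemma unit_cube_translate: "u \<in> unit_cube (b + a) S \<longleftrightarrow> u - b \<in> unit_cube a S"
  by (auto simp: unit_cube_iff algebra_simps)

lemma is_cube_neg_aux:
  fixes x :: "int ^ 'n::finite"
  assumes "is_cube k (face 0 i \<inter> face x j)"
  shows "is_cube k (face 0 j \<inter> face (- x) i)"
proof -
  have real_vec_neg: "real_vec (- x) = - real_vec x" and real_vec_0: "real_vec 0 = 0" for x :: "int ^ 'n"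
    by (simp_all add: real_vec_def vec_eq_iff)
  obtain a S where S: "card S = k" "face 0 i \<inter> face x j = unit_cube a S"
    using assms by (auto simp: is_cube_def)
  have "u \<in> face 0 j \<inter> face (- x) i \<longleftrightarrow> u \<in> unit_cube (- real_vec x + a) S" for u
  proof -
    have "u \<in> face 0 j \<inter> face (- x) i \<longleftrightarrow> u + real_vec x \<in> face 0 i \<inter> face x j"
      unfolding face_def real_vec_neg real_vec_0
      using unit_cube_translate[of u "- real_vec x" 0] unit_cube_translate[of "u + real_vec x" "real_vec x" 0]
      by auto
    also have "\<dots> \<longleftrightarrow> u \<in> unit_cube (- real_vec x + a) S"
      unfolding S unit_cube_translate by simp
    finally show ?thesis .
  qed
  then have "face 0 j \<inter> face (- x) i = unit_cube (- real_vec x + a) S" by blast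
  then show ?thesis using S(1) by (auto simp: is_cube_def)
qed

lemma is_cube_neg:
  "is_cube k (face 0 j \<inter> face (- x) i) \<longleftrightarrow> is_cube k (face 0 i \<inter> face x j)"
  using is_cube_neg_aux[of k i x j] is_cube_neg_aux[of k j "- x" i] by auto

lemma contact_nodes_neg:
  "n \<in> pm (contact_nodes v) \<Longrightarrow> n \<in> ambient_nodes v \<Longrightarrow> n \<in> contact_nodes v"
  using is_cube_neg by (cases n) (auto simp: mem_pm contact_nodes_def)

text \<open>A cube is nonempty, so the two faces share a point; this keeps every coordinate of the
  displacement between -1 and 1.\<close>

lemma finite_contact_nodes: "finite (contact_nodes v)"
proof -
  have "contact_nodes v \<subseteq> UNIV \<times> {x. \<forall>k. \<bar>x $ k\<bar> \<le> 1} \<times> UNIV"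
  proof
    fix n assume "n \<in> contact_nodes v"
    moreover obtain i x j where n: "n = (i, x, j)" by (cases n)
    ultimately obtain a S where "face 0 i \<inter> face x j = unit_cube a S"
      by (auto simp: contact_nodes_def is_cube_def)
    moreover have "a \<in> unit_cube a S" by (simp add: unit_cube_iff)
    ultimately have a: "a \<in> face 0 i" "a \<in> face x j" by blast+
    have "\<bar>x $ k\<bar> \<le> 1" for k
    proof -
      have "0 \<le> a $ k" "a $ k \<le> 1" "x $ k \<le> a $ k" "a $ k \<le> x $ k + 1"
        using a by (auto simp: face_def unit_cube_iff real_vec_def dest!: spec[of _ k] split: if_splits)
      then have "real_of_int (x $ k) \<le> 1" "real_of_int (x $ k) \<ge> - 1" by linarith+
      then show ?thesis by linarith
    qed
    then show "n \<in> UNIV \<times> {x. \<forall>k. \<bar>x $ k\<bar> \<le> 1} \<times> UNIV" by (simp add: n)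
  qed
  then show ?thesis
    by (rule finite_subset) (intro finite_cartesian_product finite finite_int_vec_bounded)
qed

text \<open>Faces are products of intervals and points, so their intersection is decided coordinate
  by coordinate. It has codimension two when exactly the coordinates \<open>k\<close> and
  \<open>l\<close> are fixed.\<close>

lemma contact_nodesI:
  fixes v :: "real ^ 'n::{finite, linorder}"
  assumes "(i, x, j) \<in> ambient_nodes v" and "k \<noteq> l"
    and comp: "\<And>m r. (if m \<noteq> i then 0 \<le> r \<and> r \<le> 1 else r = 0) \<and>
        (if m \<noteq> j then real_of_int (x $ m) \<le> r \<and> r \<le> real_of_int (x $ m) + 1 else r = real_of_int (x $ m)) \<longleftrightarrow>
      (if m \<noteq> k \<and> m \<noteq> l then a $ m \<le> r \<and> r \<le> a $ m + 1 else r = a $ m)"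
  shows "(i, x, j) \<in> contact_nodes v"
proof -
  have "card (UNIV - {k, l}) = CARD('n) - 2"
    using assms(2) by (simp add: card_Diff_subset)
  moreover have "face 0 i \<inter> face x j = unit_cube a (UNIV - {k, l})"
  proof (rule set_eqI)
    fix u
    have "u \<in> face 0 i \<inter> face x j \<longleftrightarrow> (\<forall>m. (if m \<noteq> i then 0 \<le> u $ m \<and> u $ m \<le> 1 else u $ m = 0) \<and>
        (if m \<noteq> j then real_of_int (x $ m) \<le> u $ m \<and> u $ m \<le> real_of_int (x $ m) + 1 else u $ m = real_of_int (x $ m)))"
      by (simp add: face_def unit_cube_iff real_vec_def all_conj_distrib)
    also have "\<dots> \<longleftrightarrow> u \<in> unit_cube a (UNIV - {k, l})"
      unfolding comp by (simp add: unit_cube_iff)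
    finally show "u \<in> face 0 i \<inter> face x j \<longleftrightarrow> u \<in> unit_cube a (UNIV - {k, l})" .
  qed
  ultimately show ?thesis
    unfolding contact_nodes_def is_cube_def using assms(1) by blast
qed

section \<open>Three kinds of faces in contact\<close>

lemma contact_node_same_base:
  fixes v :: "real ^ 'n::{finite, linorder}"
  assumes pos: "\<And>i. v $ i > 0" and "k \<noteq> j"
  shows "(k, 0, j) \<in> pm (contact_nodes v)"
proof -
  have "(k, 0, j) \<in> contact_nodes v" if "k < j" for k j
  proof (rule contact_nodesI[where a = 0 and k = k and l = j])
    show "(k, 0, j) \<in> ambient_nodes v"
      using that pos by (simp add: ambient_nodes_def surface_nodes_def stepped_surface_def inner_axis'
          real_vec_inner_simps)
    show "(if m \<noteq> k then 0 \<le> r \<and> r \<le> 1 else r = 0) \<and>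
        (if m \<noteq> j then real_of_int (0 $ m) \<le> r \<and> r \<le> real_of_int (0 $ m) + 1 else r = real_of_int (0 $ m)) \<longleftrightarrow>
      (if m \<noteq> k \<and> m \<noteq> j then 0 $ m \<le> r \<and> r \<le> 0 $ m + 1 else r = 0 $ m)" for m r
      by auto
  qed (use that in auto)
  then show ?thesis using \<open>k \<noteq> j\<close> by (cases k j rule: linorder_cases) (auto simp: mem_pm)
qed

text \<open>The faces meet in the cube based at \<open>axis j 1\<close> that omits the directions
  \<open>k\<close> and \<open>j\<close>. Comparing \<open>v $ k\<close> with \<open>v $ j\<close>
  decides which of the two signs is an ambient node.\<close>

lemma contact_node_exchange:
  fixes v :: "real ^ 'n::{finite, linorder}"
  assumes pos: "\<And>i. v $ i > 0" and "k \<noteq> j"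
  shows "(k, axis j 1 - axis k 1, j) \<in> pm (contact_nodes v)"
proof -
  have "(k, axis j 1 - axis k 1, j) \<in> contact_nodes v" if "k \<noteq> j" "v $ k \<le> v $ j" for k j
  proof (rule contact_nodesI[where a = "axis j 1" and k = k and l = j])
    have "(axis j 1 - axis k (1::int)) $ j \<noteq> 0 $ j" using that by (simp add: axis_def)
    then have "axis j 1 - axis k (1::int) \<noteq> 0" by metis
    then show "(k, axis j 1 - axis k 1, j) \<in> ambient_nodes v"
      using that pos[of k] by (simp add: ambient_nodes_def surface_nodes_def stepped_surface_def
          inner_axis' real_vec_inner_simps)
    show "(if m \<noteq> k then 0 \<le> r \<and> r \<le> 1 else r = 0) \<and>
        (if m \<noteq> j then real_of_int ((axis j 1 - axis k 1) $ m) \<le> r \<and> r \<le> real_of_int ((axis j 1 - axis k 1) $ m) + 1 else r = real_of_int ((axis j 1 - axis k 1) $ m)) \<longleftrightarrow>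
      (if m \<noteq> k \<and> m \<noteq> j then axis j 1 $ m \<le> r \<and> r \<le> axis j 1 $ m + 1 else r = axis j 1 $ m)" for m r
      using that(1) by (auto simp: axis_def)
  qed (use that in auto)
  from this[of k j] this[of j k] show ?thesis using \<open>k \<noteq> j\<close>
    by (cases "v $ k \<le> v $ j") (auto simp: mem_pm)
qed

lemma contact_node_parallel:
  fixes v :: "real ^ 'n::{finite, linorder}"
  assumes pos: "\<And>i. v $ i > 0" and "v $ j < v $ k"
  shows "(k, axis j 1, k) \<in> pm (contact_nodes v)"
proof -
  have kj: "k \<noteq> j" using assms(2) by auto
  have "(k, axis j 1, k) \<in> contact_nodes v"
  proof (rule contact_nodesI[where a = "axis j 1" and k = k and l = j])
    show "(k, axis j 1, k) \<in> ambient_nodes v"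
      using assms(2) pos[of j] by (simp add: ambient_nodes_def surface_nodes_def stepped_surface_def
          inner_axis' real_vec_inner_simps axis_eq_0_iff)
    show "(if m \<noteq> k then 0 \<le> r \<and> r \<le> 1 else r = 0) \<and>
        (if m \<noteq> k then real_of_int ((axis j 1) $ m) \<le> r \<and> r \<le> real_of_int ((axis j 1) $ m) + 1 else r = real_of_int ((axis j 1) $ m)) \<longleftrightarrow>
      (if m \<noteq> k \<and> m \<noteq> j then axis j 1 $ m \<le> r \<and> r \<le> axis j 1 $ m + 1 else r = axis j 1 $ m)" for m r
      using kj by (auto simp: axis_def)
  qed (use kj in auto)
  then show ?thesis by (simp add: mem_pm)
qed

section \<open>Boundedness in the contracting directions\<close>

definition mid :: "'n::finite node \<Rightarrow> int ^ 'n" where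
  "mid n = fst (snd n)"

lemma mid_simp [simp]: "mid (i, x, j) = x"
  by (simp add: mid_def)

text \<open>The length of the interval tiled by the word when letter \<open>i\<close> is a tile of
  length \<open>v $ i\<close>.\<close>

definition word_length :: "real ^ 'n::finite \<Rightarrow> 'n list \<Rightarrow> real" where
  "word_length v w = (\<Sum>i\<leftarrow>w. v $ i)"

lemma abel_inner: "real_vec (abel w) \<bullet> v = word_length v w"
proof (induction w)
  case Nil
  have "abel [] = (0 :: int ^ 'a)" by (simp add: abel_def vec_eq_iff)
  then show ?case by (simp add: word_length_def real_vec_inner_simps)
next
  case (Cons a w)
  have "abel (a # w) = axis a 1 + abel w"
    by (auto simp: abel_def vec_eq_iff axis_def)
  with Cons show ?case by (simp add: word_length_def real_vec_inner_simps)
qed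

text \<open>What the Pisot property contributes to the graph argument: an expanding eigenvalue for
  \<open>v\<close>, and contracting coordinates that, together with the coordinate along
  \<open>v\<close>, confine lattice points to finite sets.\<close>

locale pisot_setup =
  fixes \<sigma> :: "'n::{finite, linorder} subst" and v :: "real ^ ('n::{finite, linorder})" and \<beta> :: real
    and Z :: "complex set" and w :: "complex \<Rightarrow> complex ^ ('n::{finite, linorder})"
  assumes pos: "\<And>i. v $ i > 0" and \<beta>: "\<beta> > 1"
    and eigen: "v v* map_matrix of_int (incidence \<sigma>) = \<beta> *s v"
    and finite_Z: "finite Z" and contracting: "\<And>z. z \<in> Z \<Longrightarrow> cmod z < 1"
    and coord_mult: "\<And>z x. z \<in> Z \<Longrightarrow> coord (w z) (incidence \<sigma> *v x) = z * coord (w z) x"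
    and finite_box: "\<And>B. finite {x. \<bar>real_vec x \<bullet> v\<bar> \<le> B \<and> (\<forall>z\<in>Z. cmod (coord (w z) x) \<le> B)}"
begin

abbreviation "nodes \<equiv> simple_ambient_nodes v"
abbreviation "edge \<equiv> arc_rel (simple_ambient_edges \<sigma>)"
abbreviation "amb_edge \<equiv> arc_rel (ambient_edges \<sigma> v)"

definition bounded_nodes :: "real \<Rightarrow> 'n node set" where
  "bounded_nodes B = {n \<in> nodes. \<forall>z\<in>Z. cmod (coord (w z) (mid n)) \<le> B}"

lemma finite_bounded_nodes: "finite (bounded_nodes B)"
proof -
  let ?B = "max B (\<Sum>i\<in>UNIV. v $ i)"
  let ?X = "{x. \<bar>real_vec x \<bullet> v\<bar> \<le> ?B \<and> (\<forall>z\<in>Z. cmod (coord (w z) x) \<le> ?B)}"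
  have "bounded_nodes B \<subseteq> UNIV \<times> ?X \<times> UNIV"
  proof
    fix n assume n: "n \<in> bounded_nodes B"
    obtain i x j where [simp]: "n = (i, x, j)" by (cases n)
    have "v $ k \<le> (\<Sum>i\<in>UNIV. v $ i)" for k
      by (rule member_le_sum) (auto simp: less_imp_le pos)
    from this[of i] this[of j] have "\<bar>real_vec x \<bullet> v\<bar> \<le> ?B"
      using n pos by (auto simp: bounded_nodes_def mem_simple_ambient_nodes)
    then show "n \<in> UNIV \<times> ?X \<times> UNIV"
      using n by (auto simp: bounded_nodes_def le_max_iff_disj)
  qed
  then show ?thesis
    by (rule finite_subset) (intro finite_cartesian_product finite finite_box)
qed

text \<open>The factor \<open>1 - cmod z\<close> makes \<open>K\<close> the fixed point of the
  affine bound. Any level B \<ge> K is then preserved when passing from the target of an edge to its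
  source, for all \<open>z\<close> at once.\<close>

definition step_bound :: "real \<Rightarrow> bool" where
  "step_bound K \<longleftrightarrow> (\<forall>z\<in>Z. \<forall>a b. edge a b \<longrightarrow>
     cmod (coord (w z) (mid a)) \<le> cmod z * cmod (coord (w z) (mid b)) + (1 - cmod z) * K)"

text \<open>Solved for the source, the edge equation reads x = Mx' + l(p) - l(q). The words p and q
  are prefixes of images of letters, so only finitely many differences occur, and \<open>Z\<close>
  is finite too.\<close>

lemma ex_step_bound: "\<exists>K. step_bound K"
proof -
  define P where "P = (\<Union>j. (\<lambda>n. take n (\<sigma> j)) ` {..length (\<sigma> j)})"
  have "finite P" by (simp add: P_def)
  have P: "p \<in> P" if "\<sigma> j = p @ s" for p s j
    using that unfolding P_def by (intro UN_I[of j] image_eqI[of _ _ "length p"]) auto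
  define F where "F = (\<lambda>(z, p, q). cmod (coord (w z) (abel p - abel q)) / (1 - cmod z)) ` (Z \<times> P \<times> P)"
  have "finite F" using \<open>finite P\<close> finite_Z by (simp add: F_def)
  then obtain K where K: "\<And>r. r \<in> F \<Longrightarrow> r \<le> K"
    by (meson bdd_above_finite bdd_above.E)
  have "cmod (coord (w z) (mid a)) \<le> cmod z * cmod (coord (w z) (mid b)) + (1 - cmod z) * K"
    if zZ: "z \<in> Z" and ab': "edge a b" for z a b
  proof -
    obtain i x j i' x' j' where ab: "a = (i, x, j)" "b = (i', x', j')" by (cases a, cases b) auto
    obtain p s q t where e: "\<sigma> i' = p @ [i] @ s" "\<sigma> j' = q @ [j] @ t"
        "incidence \<sigma> *v x' = x + abel q - abel p"
      using ab' unfolding ab simple_rel_iff by blast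
    have "x = incidence \<sigma> *v x' + (abel p - abel q)" using e(3) by simp
    then have "coord (w z) x = z * coord (w z) x' + coord (w z) (abel p - abel q)"
      by (simp only: coord_add coord_mult[OF zZ])
    then have "cmod (coord (w z) x) \<le> cmod z * cmod (coord (w z) x') + cmod (coord (w z) (abel p - abel q))"
      by (metis norm_mult norm_triangle_ineq)
    moreover have "cmod (coord (w z) (abel p - abel q)) / (1 - cmod z) \<in> F"
      unfolding F_def using P[OF e(1)] P[OF e(2)] zZ by force
    from K[OF this] have "cmod (coord (w z) (abel p - abel q)) \<le> (1 - cmod z) * K"
      using contracting[OF zZ] by (simp add: field_simps)
    ultimately show ?thesis by (simp add: ab)
  qed
  then show ?thesis unfolding step_bound_def by blast
qed

lemma bounded_nodes_predecessor:
  assumes "step_bound K" "K \<le> B" "edge a b" "a \<in> nodes" "b \<in> bounded_nodes B"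
  shows "a \<in> bounded_nodes B"
proof -
  have "cmod (coord (w z) (mid a)) \<le> B" if "z \<in> Z" for z
  proof -
    have "cmod (coord (w z) (mid a)) \<le> cmod z * cmod (coord (w z) (mid b)) + (1 - cmod z) * K"
      using assms(1,3) that unfolding step_bound_def by blast
    also have "\<dots> \<le> cmod z * B + (1 - cmod z) * B"
      using assms(2,5) that contracting[OF that]
      by (intro add_mono mult_left_mono) (auto simp: bounded_nodes_def)
    finally show ?thesis by (simp add: algebra_simps)
  qed
  then show ?thesis using assms(4) by (simp add: bounded_nodes_def)
qed

text \<open>A node with the largest coordinate has a successor whose coordinate is no larger, and
  the contraction then pushes the maximum down to \<open>K\<close>. Finiteness is what provides the
  maximum.\<close>

lemma finite_sustaining_in_bounded:
  assumes "step_bound K" "S \<subseteq> nodes" "finite S" "sustaining edge S"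
  shows "S \<subseteq> bounded_nodes K"
proof
  fix n assume n: "n \<in> S"
  have "cmod (coord (w z) (mid n)) \<le> K" if z: "z \<in> Z" for z
  proof -
    define f where "f n = cmod (coord (w z) (mid n))" for n
    have "Max (f ` S) \<in> f ` S" using n \<open>finite S\<close> by (intro Max_in) auto
    then obtain a where "a \<in> S" "f a = Max (f ` S)" by fastforce
    then have a: "a \<in> S" "\<And>b. b \<in> S \<Longrightarrow> f b \<le> f a" using \<open>finite S\<close> by auto
    obtain b where b: "b \<in> S" "edge a b" using sustainingD[OF assms(4) a(1)] by blast
    have "f a \<le> cmod z * f b + (1 - cmod z) * K"
      using assms(1) b(2) z unfolding step_bound_def f_def by blast
    also have "\<dots> \<le> cmod z * f a + (1 - cmod z) * K"
      using a(2)[OF b(1)] by (simp add: mult_left_mono)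
    finally have "(1 - cmod z) * f a \<le> (1 - cmod z) * K" by (simp add: algebra_simps)
    then have "f a \<le> K" using contracting[OF z] by simp
    with a(2)[OF n] show ?thesis by (simp add: f_def)
  qed
  then show "n \<in> bounded_nodes K" using n assms(2) by (auto simp: bounded_nodes_def)
qed

lemma finite_finite_core: "finite (finite_core edge nodes)"
proof -
  obtain K where K: "step_bound K" using ex_step_bound by blast
  have "finite_core edge nodes \<subseteq> bounded_nodes K"
  proof
    fix n assume "n \<in> finite_core edge nodes"
    then obtain S where "n \<in> S" "S \<subseteq> nodes" "finite S" "sustaining edge S"
      by (rule finite_coreE)
    then show "n \<in> bounded_nodes K" using finite_sustaining_in_bounded[OF K] by blast
  qed
  then show ?thesis using finite_bounded_nodes finite_subset by blast
qed

lemma finite_subset_bounded: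
  assumes "finite S" "S \<subseteq> nodes"
  obtains B where "K \<le> B" "S \<subseteq> bounded_nodes B"
proof -
  define F where "F = insert K ((\<lambda>(z, n). cmod (coord (w z) (mid n))) ` (Z \<times> S))"
  have "finite F" using assms finite_Z by (simp add: F_def)
  then obtain B where B: "\<And>r. r \<in> F \<Longrightarrow> r \<le> B"
    by (meson bdd_above_finite bdd_above.E)
  have "K \<le> B" by (rule B) (simp add: F_def)
  moreover have "cmod (coord (w z) (mid n)) \<le> B" if "z \<in> Z" "n \<in> S" for z n
    using that by (intro B) (auto simp: F_def intro!: image_eqI[of _ _ "(z, n)"])
  ultimately show ?thesis using assms(2) by (intro that[of B]) (auto simp: bounded_nodes_def)
qed

section \<open>Contact sets of the ambient and the simple ambient graph\<close>

definition pre_contact :: "'n node set" where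
  "pre_contact = {n \<in> nodes. \<exists>m \<in> pm (contact_nodes v). reachable (simple_ambient_graph \<sigma> v) n m}"

definition amb_pre_contact :: "'n node set" where
  "amb_pre_contact = {n \<in> ambient_nodes v. \<exists>m \<in> contact_nodes v. reachable (ambient_graph \<sigma> v) n m}"

lemma contact_subset: "contact_nodes v \<subseteq> ambient_nodes v" "pm (contact_nodes v) \<subseteq> nodes"
proof -
  show "contact_nodes v \<subseteq> ambient_nodes v" by (auto simp: contact_nodes_def)
  then have "contact_nodes v \<subseteq> nodes" using ambient_subset_simple by blast
  then show "pm (contact_nodes v) \<subseteq> nodes"
    unfolding pm_def using simple_ambient_nodes_neg by blast
qed

lemma contact_in_pre_contact: "pm (contact_nodes v) \<subseteq> pre_contact"
  using contact_subset(2) unfolding pre_contact_def simple_ambient_graph_def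
  by (blast intro: reachable_edge_graph_refl)

lemma pre_contact_predecessor:
  assumes "edge a b" "a \<in> nodes" "b \<in> pre_contact"
  shows "a \<in> pre_contact"
  using assms reachable_edge_graph_step[of a nodes b "simple_ambient_edges \<sigma>"]
  unfolding pre_contact_def simple_ambient_graph_def by blast

text \<open>Coordinates are controlled backwards along edges, so every node that reaches the finite
  set of contact nodes stays within one bound \<open>B\<close> fitted to that set.\<close>

lemma finite_pre_contact: "finite pre_contact"
proof -
  obtain K where K: "step_bound K" using ex_step_bound by blast
  obtain B where B: "K \<le> B" "pm (contact_nodes v) \<subseteq> bounded_nodes B"
    using finite_subset_bounded[OF finite_pm[OF finite_contact_nodes] contact_subset(2)] by blast
  have "pre_contact \<subseteq> bounded_nodes B"
  proof
    fix n assume "n \<in> pre_contact"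
    then obtain m where m: "m \<in> pm (contact_nodes v)"
        "reachable (edge_graph nodes (simple_ambient_edges \<sigma>)) n m"
      unfolding pre_contact_def simple_ambient_graph_def by blast
    from m(2) show "n \<in> bounded_nodes B"
    proof (induction rule: reachable_edge_graph_induct)
      case base
      then show ?case using m(1) B(2) by blast
    next
      case (step a b)
      show ?case by (rule bounded_nodes_predecessor[OF K B(1)]) fact+
    qed
  qed
  then show ?thesis using finite_bounded_nodes finite_subset by blast
qed

lemma amb_pre_contact_subset: "amb_pre_contact \<subseteq> pre_contact"
proof
  fix n assume "n \<in> amb_pre_contact"
  then obtain m where m: "m \<in> contact_nodes v"
      "reachable (edge_graph (ambient_nodes v) (ambient_edges \<sigma> v)) n m"
    unfolding amb_pre_contact_def ambient_graph_def by blast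
  have neg: "neg_node b \<in> pre_contact" if "b \<in> pre_contact" for b
  proof -
    obtain m where m: "m \<in> pm (contact_nodes v)"
        "reachable (edge_graph nodes (simple_ambient_edges \<sigma>)) b m"
      using \<open>b \<in> pre_contact\<close> unfolding pre_contact_def simple_ambient_graph_def by blast
    from m(2) show ?thesis
    proof (induction rule: reachable_edge_graph_induct)
      case base
      then show ?case using m(1) contact_in_pre_contact by auto
    next
      case (step a b)
      then show ?case
        using pre_contact_predecessor[of "neg_node a" "neg_node b"]
        by (simp add: simple_rel_neg simple_ambient_nodes_neg)
    qed
  qed
  from m(2) show "n \<in> pre_contact"
  proof (induction rule: reachable_edge_graph_induct)
    case base
    have "m \<in> pm (contact_nodes v)" using m(1) by (simp add: mem_pm)
    then show ?case using contact_in_pre_contact by blast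
  next
    case (step a b)
    then have "a \<in> nodes" using ambient_subset_simple by blast
    moreover have "edge a b \<or> edge a (neg_node b)" using step by (simp add: ambient_rel_eq)
    ultimately show ?case using neg step pre_contact_predecessor by blast
  qed
qed

lemma pre_contact_ambient:
  assumes "n \<in> pre_contact" "n' \<in> ambient_nodes v" "n' = n \<or> n' = neg_node n"
  shows "n' \<in> amb_pre_contact"
proof -
  obtain m where m: "m \<in> pm (contact_nodes v)"
      "reachable (edge_graph nodes (simple_ambient_edges \<sigma>)) n m"
    using assms(1) unfolding pre_contact_def simple_ambient_graph_def by blast
  from m(2) assms(2,3) show ?thesis
  proof (induction arbitrary: n' rule: reachable_edge_graph_induct)
    case base
    then have "n' \<in> pm (contact_nodes v)" using m(1) by auto
    then have "n' \<in> contact_nodes v" using base contact_nodes_neg by blast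
    then show ?case
      unfolding amb_pre_contact_def ambient_graph_def
      using base reachable_edge_graph_refl by blast
  next
    case (step a b)
    obtain b' where b': "b' \<in> ambient_nodes v" "b' = b \<or> b' = neg_node b"
      using simple_ambient_cases[OF pos step.hyps(2)] by blast
    have "amb_edge n' b'"
      using step.hyps(3) step.prems(2) b'(2) simple_rel_neg[of \<sigma> a b]
      unfolding ambient_rel_eq by auto
    moreover have "b' \<in> amb_pre_contact" using step.IH b' by blast
    ultimately show ?case
      using step.prems(1) b'(1) reachable_edge_graph_step[of n' "ambient_nodes v" b' "ambient_edges \<sigma> v"]
      unfolding amb_pre_contact_def ambient_graph_def by blast
  qed
qed

definition simple_contact :: "'n node set" where
  "simple_contact = sustained_core edge pre_contact"

lemma simple_contact_graph_eq:
  "simple_contact_graph \<sigma> v = edge_graph simple_contact (simple_ambient_edges \<sigma>)"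
proof -
  have "simple_pre_contact_graph \<sigma> v = simple_ambient_graph \<sigma> v \<restriction> pre_contact"
    by (simp add: simple_pre_contact_graph_def pre_contact_def simple_ambient_graph_def)
  also have "\<dots> = edge_graph pre_contact (simple_ambient_edges \<sigma>)"
    unfolding simple_ambient_graph_def by (rule edge_graph_induce) (auto simp: pre_contact_def)
  finally show ?thesis
    by (simp add: simple_contact_graph_def simple_contact_def Red_edge_graph)
qed

lemma contact_set_eq: "contact_set \<sigma> v = sustained_core amb_edge amb_pre_contact"
proof -
  have "pre_contact_graph \<sigma> v = ambient_graph \<sigma> v \<restriction> amb_pre_contact"
    by (simp add: pre_contact_graph_def amb_pre_contact_def ambient_graph_def)
  also have "\<dots> = edge_graph amb_pre_contact (ambient_edges \<sigma> v)"
    unfolding ambient_graph_def by (rule edge_graph_induce) (auto simp: amb_pre_contact_def)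
  finally show ?thesis
    by (simp add: contact_set_def contact_graph_def Red_edge_graph)
qed

lemma simple_contact_subset: "simple_contact \<subseteq> pre_contact" "simple_contact \<subseteq> nodes"
  using sustaining_core(2)[of edge pre_contact] by (auto simp: simple_contact_def pre_contact_def)

lemma finite_contact_set: "finite (contact_set \<sigma> v)"
  unfolding contact_set_eq
  using sustaining_core(2)[of amb_edge amb_pre_contact] amb_pre_contact_subset finite_pre_contact
  by (meson finite_subset)

text \<open>Pulled-back pairs of faces will be found in \<open>simple_contact\<close>, whereas the
  corona is formed with \<open>contact_set\<close>; this inclusion links the two.\<close>

lemma simple_contact_subset_contact_set: "simple_contact \<subseteq> pm (contact_set \<sigma> v)"
proof -
  let ?S = "pm simple_contact \<inter> ambient_nodes v"
  have "sustaining amb_edge ?S"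
    using sustaining_core(1)[of edge pre_contact] simple_contact_subset(2)
    by (intro sustaining_simple_imp_ambient pos) (simp_all add: simple_contact_def)
  moreover have "?S \<subseteq> amb_pre_contact"
  proof
    fix n assume n: "n \<in> ?S"
    then have "n \<in> pre_contact \<or> neg_node n \<in> pre_contact"
      using simple_contact_subset(1) by (auto simp: mem_pm)
    then show "n \<in> amb_pre_contact"
      using pre_contact_ambient[of n n] pre_contact_ambient[of "neg_node n" n] n by auto
  qed
  ultimately have S: "?S \<subseteq> contact_set \<sigma> v"
    unfolding contact_set_eq by (intro core_maximal)
  show ?thesis
  proof
    fix n assume n: "n \<in> simple_contact"
    then have "n \<in> ambient_nodes v \<or> neg_node n \<in> ambient_nodes v"
      using simple_contact_subset(2) simple_ambient_cases[OF pos] by blast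
    moreover have "n \<in> pm simple_contact" "neg_node n \<in> pm simple_contact"
      using n by (simp_all add: mem_pm)
    ultimately show "n \<in> pm (contact_set \<sigma> v)"
      using S mem_pm[of n "contact_set \<sigma> v"] by blast
  qed
qed


section \<open>Connectedness of stepped surfaces by contact steps\<close>

text \<open>A stepped surface of height \<open>t\<close>; the paper's \<open>H\<^sub>\<sigma>\<close> is the case \<open>t = 0\<close>. Varying \<open>t\<close> makes it
  possible to put the first face of a pair at the origin.\<close>

definition surf :: "real \<Rightarrow> ((int, 'n) vec \<times> 'n) set" where
  "surf t = {(y, k). 0 \<le> real_vec y \<bullet> v + t \<and> real_vec y \<bullet> v + t < v $ k}"

definition disp :: "(int, 'n) vec \<times> 'n \<Rightarrow> (int, 'n) vec \<times> 'n \<Rightarrow> 'n node" where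
  "disp f g = (snd f, fst g - fst f, snd g)"

text \<open>Trivial displacements are included, so that a move by one contact step can be padded to
  two and all moves have the same length.\<close>

definition adjacent :: "real \<Rightarrow> (int, 'n) vec \<times> 'n \<Rightarrow> (int, 'n) vec \<times> 'n \<Rightarrow> bool" where
  "adjacent t f g \<longleftrightarrow> f \<in> surf t \<and> g \<in> surf t \<and> disp f g \<in> pm (contact_nodes v) \<union> trivial_nodes"

lemma mem_surf: "(y, k) \<in> surf t \<longleftrightarrow> 0 \<le> real_vec y \<bullet> v + t \<and> real_vec y \<bullet> v + t < v $ k"
  by (simp add: surf_def)

lemma disp_trivial: "disp f g \<in> trivial_nodes \<longleftrightarrow> f = g"
  by (auto simp: disp_def trivial_nodes_def prod_eq_iff)

lemma neg_disp: "neg_node (disp f g) = disp g f"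
  by (simp add: disp_def)

lemma disp_nodes:
  assumes "f \<in> surf t" "g \<in> surf t" "f \<noteq> g"
  shows "disp f g \<in> nodes"
proof -
  have "disp f g \<notin> trivial_nodes" using assms(3) disp_trivial by blast
  then show ?thesis
    using assms(1,2) unfolding disp_def
    by (cases f, cases g) (auto simp: mem_surf mem_simple_ambient_nodes pos real_vec_inner_simps)
qed

lemma adjacent_sym: "adjacent t f g \<Longrightarrow> adjacent t g f"
  unfolding adjacent_def by (metis UnCI UnE disp_trivial neg_disp neg_mem_pm)

lemma adjacent_refl: "f \<in> surf t \<Longrightarrow> adjacent t f f"
  by (simp add: adjacent_def disp_trivial)

lemma two_steps: "adjacent t f g \<Longrightarrow> adjacent t g h \<Longrightarrow> (adjacent t ^^ 2) f h"
  unfolding numeral_2_eq_2 by (meson relpowp_0_I relpowp_Suc_I)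

lemma adjacent_same_base:
  assumes "(y, k) \<in> surf t" "(y, j) \<in> surf t"
  shows "adjacent t (y, k) (y, j)"
  using assms contact_node_same_base[OF pos, of k j]
  by (cases "k = j") (simp_all add: adjacent_def disp_def trivial_nodes_def)

lemma adjacent_exchange:
  assumes "(y, k) \<in> surf t" "(y + axis j 1 - axis k 1, j) \<in> surf t"
  shows "adjacent t (y, k) (y + axis j 1 - axis k 1, j)"
  using assms contact_node_exchange[OF pos, of k j]
  by (cases "k = j") (simp_all add: adjacent_def disp_def trivial_nodes_def diff_add_eq)

lemma adjacent_parallel:
  assumes "(y, k) \<in> surf t" "(y + axis j 1, k) \<in> surf t"
  shows "adjacent t (y, k) (y + axis j 1, k)"
proof -
  have "v $ j < v $ k" using assms by (simp add: mem_surf real_vec_inner_simps)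
  then show ?thesis
    using assms contact_node_parallel[OF pos] by (simp add: adjacent_def disp_def)
qed

text \<open>Among the faces of the type \<open>m\<close> with the largest \<open>v $ m\<close>, the base points are parametrized
  by their coordinates other than \<open>m\<close>, and each unit step in these coordinates is possible.\<close>

lemma unit_step_up:
  assumes "\<And>j. v $ j \<le> v $ m" "(y, m) \<in> surf t" "j \<noteq> m"
  obtains y' where "(y', m) \<in> surf t" "(adjacent t ^^ 2) (y, m) (y', m)"
    "\<And>l. l \<noteq> m \<Longrightarrow> y' $ l = y $ l + (if l = j then 1 else 0)"
proof (cases "real_vec y \<bullet> v + t + v $ j < v $ m")
  case True
  let ?y = "y + axis j 1"
  have "(?y, m) \<in> surf t"
    using True assms(2) pos[of j] by (simp add: mem_surf real_vec_inner_simps)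
  moreover from this have "(adjacent t ^^ 2) (y, m) (?y, m)"
    using adjacent_parallel[OF assms(2)] adjacent_refl two_steps by blast
  ultimately show ?thesis using assms(3) by (intro that[of ?y]) (auto simp: axis_def)
next
  case False
  \<comment> \<open>Adding \<open>axis j 1\<close> alone would leave the surface. Subtracting
    \<open>axis m 1\<close> compensates and affects only the coordinate that the parametrization
    ignores. The path runs through the face of type \<open>j\<close> at the new base.\<close>
  let ?y = "y + axis j 1 - axis m 1"
  have j: "(?y, j) \<in> surf t"
    using False assms(2) by (simp add: mem_surf real_vec_inner_simps)
  then have m: "(?y, m) \<in> surf t"
    using assms(1)[of j] by (simp add: mem_surf)
  have "(adjacent t ^^ 2) (y, m) (?y, m)"
    using adjacent_exchange[OF assms(2) j] adjacent_same_base[OF j m] by (rule two_steps)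
  with m show ?thesis using assms(3) by (intro that[of ?y]) (auto simp: axis_def)
qed

lemma unit_step_down:
  assumes "\<And>j. v $ j \<le> v $ m" "(y, m) \<in> surf t" "j \<noteq> m"
  obtains y' where "(y', m) \<in> surf t" "(adjacent t ^^ 2) (y, m) (y', m)"
    "\<And>l. l \<noteq> m \<Longrightarrow> y' $ l = y $ l - (if l = j then 1 else 0)"
proof (cases "v $ j \<le> real_vec y \<bullet> v + t")
  case True
  let ?y = "y - axis j 1"
  have m: "(?y, m) \<in> surf t"
    using True assms(2) pos[of j] by (simp add: mem_surf real_vec_inner_simps)
  have "adjacent t (y, m) (?y, m)"
    using adjacent_parallel[OF m, of j] assms(2) by (auto intro!: adjacent_sym[of t "(y - axis j 1, m)"])
  then have "(adjacent t ^^ 2) (y, m) (?y, m)"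
    using adjacent_refl[OF m] by (rule two_steps)
  with m show ?thesis using assms(3) by (intro that[of ?y]) (auto simp: axis_def)
next
  case False
  let ?y = "y + axis m 1 - axis j 1"
  have j: "(y, j) \<in> surf t"
    using False assms(2) by (simp add: mem_surf)
  have m: "(?y, m) \<in> surf t"
    using False assms(1)[of j] assms(2) by (simp add: mem_surf real_vec_inner_simps)
  have "(adjacent t ^^ 2) (y, m) (?y, m)"
    using adjacent_same_base[OF assms(2) j] adjacent_exchange[OF j m] by (rule two_steps)
  with m show ?thesis using assms(3) by (intro that[of ?y]) (auto simp: axis_def)
qed

text \<open>Each unit step towards \<open>y'\<close> costs two contact steps. Once all coordinates
  except \<open>m\<close> agree, the heights differ by an integer multiple of \<open>v $ m\<close>
  while lying in a half-open interval of that length, so the base points coincide.\<close>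

lemma chain_max_type:
  assumes "\<And>j. v $ j \<le> v $ m" "(y, m) \<in> surf t" "(y', m) \<in> surf t"
    and "(\<Sum>l\<in>UNIV - {m}. nat \<bar>y' $ l - y $ l\<bar>) = L"
  shows "(adjacent t ^^ (2 * L)) (y, m) (y', m)"
  using assms(2,4)
proof (induction L arbitrary: y)
  case 0
  have eq: "y' $ l = y $ l" if "l \<noteq> m" for l
    using 0(2) that by auto
  have "real_of_int ((y' - y) $ l) = (real_of_int (y' $ m - y $ m) *\<^sub>R axis m 1) $ l" for l
    using eq[of l] by (cases "l = m") (simp_all add: axis_def)
  then have "real_vec (y' - y) = real_of_int (y' $ m - y $ m) *\<^sub>R axis m 1"
    by (simp only: real_vec_def vec_eq_iff vec_lambda_beta simp_thms)
  then have diff: "real_vec y' \<bullet> v - real_vec y \<bullet> v = real_of_int (y' $ m - y $ m) * v $ m"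
    by (simp add: inner_axis' flip: real_vec_inner_simps(2))
  have "\<bar>real_vec y' \<bullet> v - real_vec y \<bullet> v\<bar> < v $ m"
    using 0(1) assms(3) by (simp add: mem_surf abs_if)
  then have "\<bar>real_of_int (y' $ m - y $ m)\<bar> * v $ m < 1 * v $ m"
    using pos[of m] by (simp add: diff abs_mult)
  then have "\<bar>real_of_int (y' $ m - y $ m)\<bar> < 1"
    using pos[of m] by (simp only: mult_less_cancel_right)
  then have "y' $ m = y $ m" by linarith
  with eq have "y' = y" by (metis vec_eq_iff)
  then show ?case by simp
next
  case (Suc L)
  have "\<exists>j\<in>UNIV - {m}. y' $ j \<noteq> y $ j"
  proof (rule ccontr)
    assume "\<not> (\<exists>j\<in>UNIV - {m}. y' $ j \<noteq> y $ j)"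
    then have "(\<Sum>l\<in>UNIV - {m}. nat \<bar>y' $ l - y $ l\<bar>) = 0" by simp
    with Suc.prems(2) show False by simp
  qed
  then obtain j where j: "j \<noteq> m" "y' $ j \<noteq> y $ j" by blast
  obtain z where z: "(z, m) \<in> surf t" "(adjacent t ^^ 2) (y, m) (z, m)"
    "\<And>l. l \<noteq> m \<Longrightarrow> z $ l = y $ l + (if l = j then sgn (y' $ j - y $ j) else 0)"
  proof (cases "y $ j < y' $ j")
    case True
    then have "sgn (y' $ j - y $ j) = 1" by simp
    with unit_step_up[OF assms(1) Suc.prems(1) j(1)] that show ?thesis by metis
  next
    case False
    then have s: "sgn (y' $ j - y $ j) = - 1" using j(2) by simp
    obtain z where "(z, m) \<in> surf t" "(adjacent t ^^ 2) (y, m) (z, m)"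
      "\<And>l. l \<noteq> m \<Longrightarrow> z $ l = y $ l - (if l = j then 1 else 0)"
      using unit_step_down[OF assms(1) Suc.prems(1) j(1)] by metis
    then show ?thesis by (intro that[of z]) (simp_all add: s)
  qed
  have "(\<Sum>l\<in>UNIV - {m}. nat \<bar>y' $ l - y $ l\<bar>) = Suc (\<Sum>l\<in>UNIV - {m}. nat \<bar>y' $ l - z $ l\<bar>)"
  proof -
    have "(\<Sum>l\<in>UNIV - {m}. nat \<bar>y' $ l - y $ l\<bar>) =
        nat \<bar>y' $ j - y $ j\<bar> + (\<Sum>l\<in>UNIV - {m} - {j}. nat \<bar>y' $ l - y $ l\<bar>)"
      using j(1) by (intro sum.remove) auto
    also have "(\<Sum>l\<in>UNIV - {m} - {j}. nat \<bar>y' $ l - y $ l\<bar>) = (\<Sum>l\<in>UNIV - {m} - {j}. nat \<bar>y' $ l - z $ l\<bar>)"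
      by (rule sum.cong) (auto simp: z(3))
    also have "nat \<bar>y' $ j - y $ j\<bar> = Suc (nat \<bar>y' $ j - z $ j\<bar>)"
      using j z(3)[OF j(1)] by (auto simp: sgn_if)
    also have "Suc (nat \<bar>y' $ j - z $ j\<bar>) + (\<Sum>l\<in>UNIV - {m} - {j}. nat \<bar>y' $ l - z $ l\<bar>) =
        Suc (\<Sum>l\<in>UNIV - {m}. nat \<bar>y' $ l - z $ l\<bar>)"
      using j(1) sum.remove[of "UNIV - {m}" j "\<lambda>l. nat \<bar>y' $ l - z $ l\<bar>"] by simp
    finally show ?thesis .
  qed
  with Suc.prems(2) have "(adjacent t ^^ (2 * L)) (z, m) (y', m)"
    by (intro Suc.IH z(1)) simp
  with z(2) have "(adjacent t ^^ (2 + 2 * L)) (y, m) (y', m)"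
    unfolding relpowp_add by blast
  then show ?case by simp
qed

text \<open>The extra 2 pays for changing type to \<open>m\<close> at the first base and back at the
  last; maximality of \<open>v $ m\<close> keeps these faces on the surface. The bound depends only
  on the displacement and not on \<open>t\<close>, so it is uniform over levels.\<close>

lemma surf_connected:
  assumes "(y, k) \<in> surf t" "(y', k') \<in> surf t"
  shows "\<exists>l \<le> 2 * (\<Sum>l\<in>UNIV. nat \<bar>y' $ l - y $ l\<bar>) + 2. (adjacent t ^^ l) (y, k) (y', k')"
proof -
  obtain m where m: "\<And>j. v $ j \<le> v $ m"
  proof -
    have "Max (range (($) v)) \<in> range (($) v)" by (rule Max_in) auto
    then obtain m where "v $ m = Max (range (($) v))" by force
    then show ?thesis by (intro that[of m]) simp
  qed
  define L where "L = (\<Sum>l\<in>UNIV - {m}. nat \<bar>y' $ l - y $ l\<bar>)"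
  have y: "(y, m) \<in> surf t" "(y', m) \<in> surf t"
    using assms m[of k] m[of k'] by (simp_all add: mem_surf)
  have "adjacent t (y, k) (y, m)" "adjacent t (y', m) (y', k')"
    using adjacent_same_base assms y by blast+
  moreover have "(adjacent t ^^ (2 * L)) (y, m) (y', m)"
    by (rule chain_max_type[OF m y]) (simp add: L_def)
  ultimately have "(adjacent t ^^ Suc (Suc (2 * L))) (y, k) (y', k')"
    by (meson relpowp_Suc_I relpowp_Suc_I2)
  moreover have "L \<le> (\<Sum>l\<in>UNIV. nat \<bar>y' $ l - y $ l\<bar>)"
    unfolding L_def by (rule sum_mono2) auto
  ultimately show ?thesis by (intro exI[of _ "Suc (Suc (2 * L))"]) simp
qed


section \<open>Parents of faces under the dual substitution\<close>

lemma eigen_inner: "real_vec (incidence \<sigma> *v x) \<bullet> v = \<beta> * (real_vec x \<bullet> v)"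
proof -
  have "real_vec (incidence \<sigma> *v x) = map_matrix of_int (incidence \<sigma>) *v real_vec x"
    by (simp add: vec_eq_iff real_vec_def matrix_vector_mult_def)
  then have "real_vec (incidence \<sigma> *v x) \<bullet> v = (v v* map_matrix of_int (incidence \<sigma>)) \<bullet> real_vec x"
    by (metis dot_lmul_matrix inner_commute)
  also have "\<dots> = \<beta> * (real_vec x \<bullet> v)"
    unfolding eigen by (simp add: scalar_mult_eq_scaleR inner_commute)
  finally show ?thesis .
qed

lemma word_length_image: "word_length v (\<sigma> k) = \<beta> * v $ k"
  using eigen_inner[of "abel [k]"] by (simp add: incidence_abel_letter abel_inner) (simp add: word_length_def)

lemma word_length_simps [simp]:
  "word_length v [] = 0" "word_length v (a # u) = v $ a + word_length v u"
  "word_length v (p @ q) = word_length v p + word_length v q"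
  by (simp_all add: word_length_def)

lemma word_length_nonneg: "0 \<le> word_length v u"
  by (induction u) (simp_all add: less_imp_le pos)

text \<open>The word tiles an interval by half-open tiles, one of which contains \<open>s\<close>.
  This gives existence of parents; \<open>cut_unique\<close> gives their uniqueness.\<close>

lemma ex_cut:
  assumes "0 \<le> s" "s < word_length v u"
  shows "\<exists>q k r. u = q @ [k] @ r \<and> word_length v q \<le> s \<and> s < word_length v q + v $ k"
  using assms
proof (induction u arbitrary: s)
  case (Cons a u)
  show ?case
  proof (cases "s < v $ a")
    case True
    then show ?thesis using Cons.prems by (intro exI[of _ "[]"]) auto
  next
    case False
    then obtain q k r where "u = q @ [k] @ r" "word_length v q \<le> s - v $ a"
        "s - v $ a < word_length v q + v $ k"
      using Cons.IH[of "s - v $ a"] Cons.prems by auto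
    then show ?thesis by (intro exI[of _ "a # q"] exI[of _ k] exI[of _ r]) auto
  qed
qed simp

lemma cut_unique:
  assumes "q @ [k] @ r = q' @ [k'] @ r'"
    and "word_length v q \<le> s" "s < word_length v q + v $ k"
    and "word_length v q' \<le> s" "s < word_length v q' + v $ k'"
  shows "q = q' \<and> k = k'"
proof -
  have False if "q @ [k] @ r = q' @ [k'] @ r'" "length q < length q'" "s < word_length v q + v $ k"
    "word_length v q' \<le> s" for q k r q' k' r'
  proof -
    have "q' = take (length q') (q @ [k] @ r)" using that(1) by (metis append_eq_conv_conj)
    also have "\<dots> = q @ [k] @ take (length q' - length q - 1) r"
      using that(2) by (cases "length q' - length q") auto
    finally have "word_length v q' = word_length v q + v $ k + word_length v (take (length q' - length q - 1) r)"
      by (metis add.assoc add.commute word_length_simps append_Cons append_Nil)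
    then show False using that(3,4) word_length_nonneg[of "take (length q' - length q - 1) r"] by linarith
  qed
  then have "length q = length q'"
    using assms by (metis linorder_neqE_nat)
  then show ?thesis using assms(1) by simp
qed

text \<open>The height of \<open>f'\<close> is scaled by \<open>\<beta>\<close> and located in the
  tiling of the image of its letter; the tile it hits is the letter of the parent. The word
  \<open>p\<close> only translates the parent surface.\<close>

definition is_parent :: "real \<Rightarrow> 'n list \<Rightarrow> (int, 'n) vec \<times> 'n \<Rightarrow> (int, 'n) vec \<times> 'n \<Rightarrow> bool" where
  "is_parent t p f' f \<longleftrightarrow> (\<exists>q r. \<sigma> (snd f') = q @ [snd f] @ r \<and>
     fst f = incidence \<sigma> *v fst f' + abel p - abel q \<and>
     word_length v q \<le> \<beta> * (real_vec (fst f') \<bullet> v + t) \<and>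
     \<beta> * (real_vec (fst f') \<bullet> v + t) < word_length v q + v $ snd f)"

definition parent :: "real \<Rightarrow> 'n list \<Rightarrow> (int, 'n) vec \<times> 'n \<Rightarrow> (int, 'n) vec \<times> 'n" where
  "parent t p f' = (SOME f. is_parent t p f' f)"

lemma parent_eqI: "is_parent t p f' f \<Longrightarrow> parent t p f' = f"
  unfolding parent_def
proof (rule some_equality)
  fix g assume "is_parent t p f' f" "is_parent t p f' g"
  then obtain q r q' r' where
    f: "\<sigma> (snd f') = q @ [snd f] @ r" "fst f = incidence \<sigma> *v fst f' + abel p - abel q"
      "word_length v q \<le> \<beta> * (real_vec (fst f') \<bullet> v + t)"
      "\<beta> * (real_vec (fst f') \<bullet> v + t) < word_length v q + v $ snd f" and
    g: "\<sigma> (snd f') = q' @ [snd g] @ r'" "fst g = incidence \<sigma> *v fst f' + abel p - abel q'"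
      "word_length v q' \<le> \<beta> * (real_vec (fst f') \<bullet> v + t)"
      "\<beta> * (real_vec (fst f') \<bullet> v + t) < word_length v q' + v $ snd g"
    unfolding is_parent_def by blast
  have "q' = q \<and> snd g = snd f"
    by (rule cut_unique[OF trans[OF g(1)[symmetric] f(1)] g(3,4) f(3,4)])
  then show "g = f" using f(2) g(2) by (simp add: prod_eq_iff)
qed

text \<open>A cut exists because the image of a letter has length \<open>\<beta>\<close> times that
  of the letter. The parent has height equal to the scaled height minus
  \<open>word_length v q\<close>, so the cut conditions are precisely membership in the new
  surface.\<close>

lemma parent_surf:
  assumes "f' \<in> surf t"
  shows "is_parent t p f' (parent t p f')" "parent t p f' \<in> surf (\<beta> * t - word_length v p)"
proof -
  obtain y k where [simp]: "f' = (y, k)" by (cases f')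
  let ?s = "\<beta> * (real_vec y \<bullet> v + t)"
  have "0 \<le> ?s" "?s < word_length v (\<sigma> k)"
    using assms \<beta> by (simp_all add: mem_surf word_length_image)
  then obtain q j r where q: "\<sigma> k = q @ [j] @ r" "word_length v q \<le> ?s" "?s < word_length v q + v $ j"
    using ex_cut by blast
  define f where "f = (incidence \<sigma> *v y + abel p - abel q, j)"
  have par: "is_parent t p f' f"
    unfolding is_parent_def f_def using q by (intro exI[of _ q] exI[of _ r]) simp
  then have eq: "parent t p f' = f" by (rule parent_eqI)
  with par show "is_parent t p f' (parent t p f')" by simp
  show "parent t p f' \<in> surf (\<beta> * t - word_length v p)"
    unfolding eq f_def
    using q(2,3) by (simp add: mem_surf real_vec_inner_simps eigen_inner abel_inner algebra_simps)
qed

text \<open>The common translation by \<open>p\<close> cancels in the displacement, leaving the edge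
  equation for the two cut prefixes.\<close>

lemma parent_edge:
  assumes "f \<in> surf t" "g \<in> surf t"
  shows "edge (disp (parent t p f) (parent t p g)) (disp f g)"
proof -
  obtain q r q' r' where
    "\<sigma> (snd f) = q @ [snd (parent t p f)] @ r" "fst (parent t p f) = incidence \<sigma> *v fst f + abel p - abel q"
    "\<sigma> (snd g) = q' @ [snd (parent t p g)] @ r'" "fst (parent t p g) = incidence \<sigma> *v fst g + abel p - abel q'"
    using parent_surf(1)[OF assms(1), of p] parent_surf(1)[OF assms(2), of p] unfolding is_parent_def by blast
  moreover have "incidence \<sigma> *v (fst g - fst f) = incidence \<sigma> *v fst g - incidence \<sigma> *v fst f"
    by (simp add: vec_eq_iff matrix_vector_mult_def right_diff_distrib sum_subtractf)
  ultimately show ?thesis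
    unfolding disp_def simple_rel_iff
    by (intro exI[of _ q] exI[of _ r] exI[of _ q'] exI[of _ r']) simp
qed

section \<open>Pulling chains back along a walk\<close>

definition corona_nodes :: "'n node set \<Rightarrow> 'n node set" where
  "corona_nodes A = {(i, x, j) \<in> nodes. \<exists>y k. (i, y, k) \<in> A \<and>
     (k, x - y, j) \<in> pm (contact_set \<sigma> v) \<union> trivial_nodes}"

lemma corona_edge_graph:
  "corona \<sigma> v (edge_graph A (simple_ambient_edges \<sigma>)) = edge_graph (corona_nodes A) (simple_ambient_edges \<sigma>)"
  unfolding corona_def simple_ambient_graph_def edge_graph_simps corona_nodes_def
  by (rule edge_graph_induce) auto

lemma corona_nodes_subset: "corona_nodes A \<subseteq> nodes"
  by (auto simp: corona_nodes_def)

lemma subset_corona_nodes: "A \<subseteq> nodes \<Longrightarrow> A \<subseteq> corona_nodes A"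
proof
  fix n assume "A \<subseteq> nodes" "n \<in> A"
  moreover obtain i x j where "n = (i, x, j)" by (cases n)
  moreover have "(j, x - x, j) \<in> trivial_nodes" by (simp add: trivial_nodes_def)
  ultimately show "n \<in> corona_nodes A" unfolding corona_nodes_def by blast
qed

lemma disp_in_corona:
  assumes "disp b g \<in> nodes" "disp b f \<in> A" "disp f g \<in> pm (contact_set \<sigma> v) \<union> trivial_nodes"
  shows "disp b g \<in> corona_nodes A"
proof -
  have "(snd f, (fst g - fst b) - (fst f - fst b), snd g) = disp f g"
    by (simp add: disp_def)
  with assms(3) have "\<exists>y k. (snd b, y, k) \<in> A \<and>
      (k, fst g - fst b - y, snd g) \<in> pm (contact_set \<sigma> v) \<union> trivial_nodes"
    using assms(2) by (intro exI[of _ "fst f - fst b"] exI[of _ "snd f"] conjI) (simp_all add: disp_def)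
  with assms(1) show ?thesis
    unfolding corona_nodes_def disp_def by blast
qed

lemma finite_corona_nodes:
  assumes "finite A"
  shows "finite (corona_nodes A)"
proof -
  let ?D = "insert 0 (mid ` pm (contact_set \<sigma> v))"
  have "corona_nodes A \<subseteq> UNIV \<times> (\<lambda>(y, d). y + d) ` (mid ` A \<times> ?D) \<times> UNIV"
  proof
    fix n assume "n \<in> corona_nodes A"
    moreover obtain i x j where n: "n = (i, x, j)" by (cases n)
    ultimately obtain y k where yk: "(i, y, k) \<in> A" "(k, x - y, j) \<in> pm (contact_set \<sigma> v) \<union> trivial_nodes"
      unfolding corona_nodes_def by blast
    have "y \<in> mid ` A" using yk(1) by (rule image_eqI[rotated]) simp
    moreover have "x - y \<in> ?D"
    proof (cases "(k, x - y, j) \<in> trivial_nodes")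
      case True
      then show ?thesis by (auto simp: trivial_nodes_def)
    next
      case False
      then have "(k, x - y, j) \<in> pm (contact_set \<sigma> v)" using yk(2) by blast
      then show ?thesis by (intro insertI2 image_eqI[where x = "(k, x - y, j)"]) simp_all
    qed
    ultimately have "x \<in> (\<lambda>(y, d). y + d) ` (mid ` A \<times> ?D)"
      by (intro image_eqI[of _ _ "(y, x - y)"]) auto
    then show "n \<in> UNIV \<times> (\<lambda>(y, d). y + d) ` (mid ` A \<times> ?D) \<times> UNIV" by (simp add: n)
  qed
  moreover have "finite ?D"
    using finite_pm[OF finite_contact_set] by blast
  ultimately show ?thesis
    using assms by (elim finite_subset) (intro finite_cartesian_product finite finite_imageI)
qed

text \<open>\<open>anc t p k r f\<close> is the ancestor at level \<open>r\<close> of a face \<open>f\<close> at level \<open>r + k\<close>.\<close>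

primrec anc :: "(nat \<Rightarrow> real) \<Rightarrow> (nat \<Rightarrow> 'n list) \<Rightarrow> nat \<Rightarrow> nat \<Rightarrow> (int, 'n) vec \<times> 'n \<Rightarrow> (int, 'n) vec \<times> 'n" where
  "anc t p 0 r f = f"
| "anc t p (Suc k) r f = parent (t (Suc r)) (p r) (anc t p k (Suc r) f)"

lemma anc_add: "anc t p (m + k) r f = anc t p m r (anc t p k (r + m) f)"
  by (induction m arbitrary: r) simp_all

context
  fixes t :: "nat \<Rightarrow> real" and p :: "nat \<Rightarrow> 'n list"
  assumes level: "\<And>r. t r = \<beta> * t (Suc r) - word_length v (p r)"
begin

lemma anc_surf: "f \<in> surf (t (r + k)) \<Longrightarrow> anc t p k r f \<in> surf (t r)"
proof (induction k arbitrary: r)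
  case (Suc k)
  then have "anc t p k (Suc r) f \<in> surf (t (Suc r))" by simp
  then show ?case using parent_surf(2)[of _ "t (Suc r)" "p r"] level[of r] by simp
qed simp

lemma anc_edge:
  assumes "f \<in> surf (t (Suc r + k))" "g \<in> surf (t (Suc r + k))"
  shows "edge (disp (anc t p (Suc k) r f) (anc t p (Suc k) r g)) (disp (anc t p k (Suc r) f) (anc t p k (Suc r) g))"
  using parent_edge anc_surf[OF assms(1)] anc_surf[OF assms(2)] by simp

text \<open>Faces with equal ancestors at some level agree at all lower ones. If they are still
  distinct at level \<open>r\<close>, all pairs in between are nontrivial and form a walk in
  \<open>nodes\<close>.\<close>

lemma anc_walk:
  assumes "f \<in> surf (t (r + k))" "g \<in> surf (t (r + k))" "anc t p k r f \<noteq> anc t p k r g" "m \<le> k"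
  shows "disp (anc t p (k - m) (r + m) f) (anc t p (k - m) (r + m) g) \<in> nodes"
    and "m < k \<Longrightarrow> edge (disp (anc t p (k - m) (r + m) f) (anc t p (k - m) (r + m) g))
      (disp (anc t p (k - Suc m) (r + Suc m) f) (anc t p (k - Suc m) (r + Suc m) g))"
proof -
  have "anc t p (k - m) (r + m) f \<noteq> anc t p (k - m) (r + m) g"
    using assms(3,4) anc_add[of t p m "k - m" r f] anc_add[of t p m "k - m" r g] by auto
  moreover have "anc t p (k - m) (r + m) f \<in> surf (t (r + m))" "anc t p (k - m) (r + m) g \<in> surf (t (r + m))"
    using assms(1,2,4) by (simp_all add: anc_surf)
  ultimately show "disp (anc t p (k - m) (r + m) f) (anc t p (k - m) (r + m) g) \<in> nodes"
    by (intro disp_nodes)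
  assume "m < k"
  then have "Suc (r + m) + (k - Suc m) = r + k" "k - m = Suc (k - Suc m)" by simp_all
  then show "edge (disp (anc t p (k - m) (r + m) f) (anc t p (k - m) (r + m) g))
      (disp (anc t p (k - Suc m) (r + Suc m) f) (anc t p (k - Suc m) (r + Suc m) g))"
    using anc_edge[of f "r + m" "k - Suc m" g] assms(1,2) by simp
qed

text \<open>Unless the two faces merge, their displacements form a walk ending in a contact node,
  hence a walk inside \<open>pre_contact\<close>. With at least \<open>card pre_contact\<close>
  steps, its start lies in the reduction.\<close>

lemma adjacent_anc:
  assumes "adjacent (t (r + k)) f g" "card pre_contact \<le> k"
  shows "disp (anc t p k r f) (anc t p k r g) \<in> simple_contact \<union> trivial_nodes"
proof (cases "anc t p k r f = anc t p k r g")
  case True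
  then show ?thesis by (simp add: disp_trivial)
next
  case False
  have fg: "f \<in> surf (t (r + k))" "g \<in> surf (t (r + k))"
      "disp f g \<in> pm (contact_nodes v) \<union> trivial_nodes"
    using assms(1) by (simp_all add: adjacent_def)
  define a where "a m = disp (anc t p (k - m) (r + m) f) (anc t p (k - m) (r + m) g)" for m
  have walk: "a m \<in> nodes" "m < k \<Longrightarrow> edge (a m) (a (Suc m))" if "m \<le> k" for m
    unfolding a_def using anc_walk[OF fg(1,2) False] that by blast+
  have "f \<noteq> g" using False by blast
  then have "a k \<in> pm (contact_nodes v)" using fg(3) disp_trivial by (auto simp: a_def)
  have "a m \<in> pre_contact" if "m \<le> k" for m
    using that
  proof (induction rule: inc_induct)
    case base
    then show ?case using \<open>a k \<in> _\<close> contact_in_pre_contact by blast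
  next
    case (step m)
    then show ?case using pre_contact_predecessor[of "a m" "a (Suc m)"] walk[of m] by simp
  qed
  then have "a 0 \<in> simple_contact"
    unfolding simple_contact_def using walk(2) by (intro long_walk_in_core[OF finite_pre_contact assms(2)]) simp_all
  then show ?thesis by (simp add: a_def)
qed

context
  fixes A :: "'n node set" and N :: nat and b :: "nat \<Rightarrow> (int, 'n) vec \<times> 'n"
  assumes A: "A \<subseteq> nodes" "simple_contact \<subseteq> A" "finite (corona_nodes A)"
      "sustained_core edge (corona_nodes A) \<subseteq> A"
    and N: "card pre_contact \<le> N" "card (corona_nodes A) \<le> N"
    and b: "\<And>r. b r \<in> surf (t r)" "\<And>r. parent (t (Suc r)) (p r) (b (Suc r)) = b r"
begin

lemma anc_base: "anc t p k r (b (r + k)) = b r"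
proof (induction k arbitrary: r)
  case (Suc k)
  from this[of "Suc r"] show ?case by (simp add: b(2))
qed simp

text \<open>Every chain step consumes \<open>N\<close> levels. The induction hypothesis is applied
  not only at \<open>r\<close> but at all levels up to \<open>r + N\<close>, so that the last step
  yields a whole walk in the corona instead of a single corona node.\<close>

lemma chain_anc:
  assumes "(adjacent (t (r + k)) ^^ l) (b (r + k)) f" "(l + 1) * N \<le> k"
  shows "disp (b r) (anc t p k r f) \<in> A \<union> trivial_nodes"
  using assms
proof (induction l arbitrary: f r k)
  case 0
  then have "f = b (r + k)" by simp
  then show ?case by (simp add: anc_base disp_trivial)
next
  case (Suc l g)
  obtain f where f: "(adjacent (t (r + k)) ^^ l) (b (r + k)) f" "adjacent (t (r + k)) f g"
    using Suc.prems(1) by (auto elim: relpowp_Suc_E)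
  have g: "g \<in> surf (t (r + k))" using f(2) by (simp add: adjacent_def)
  have k: "N + (l + 1) * N \<le> k" using Suc.prems(2) by simp
  show ?case
  proof (cases "b r = anc t p k r g")
    case True
    then show ?thesis by (simp add: disp_trivial)
  next
    case False
    then have ne: "anc t p k r (b (r + k)) \<noteq> anc t p k r g" by (simp add: anc_base)
    define a where "a m = disp (b (r + m)) (anc t p (k - m) (r + m) g)" for m
    have base: "anc t p (k - m) (r + m) (b (r + k)) = b (r + m)" if "m \<le> k" for m
      using anc_base[of "k - m" "r + m"] that by simp
    have walk: "a m \<in> nodes" if "m \<le> k" for m
      using anc_walk(1)[OF b(1) g ne that] that by (simp add: a_def base)
    have "edge (a m) (a (Suc m))" if "m < k" for m
      using anc_walk(2)[OF b(1) g ne, of m] that base[of m] base[of "Suc m"] by (simp add: a_def)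
    \<comment> \<open>At level \<open>r + m\<close> the ancestor of \<open>f\<close> is in
      \<open>A\<close> relative to the base face, and the ancestor of \<open>g\<close> is in contact
      with it. If the ancestor of \<open>f\<close> is the base face itself, the pair is a contact
      node and lies in \<open>A\<close> directly.\<close>
    moreover have "a m \<in> corona_nodes A" if "m \<le> N" for m
    proof -
      have m: "m \<le> k" "(l + 1) * N \<le> k - m" "card pre_contact \<le> k - m" "r + m + (k - m) = r + k"
        using that k N by simp_all
      let ?f = "anc t p (k - m) (r + m) f"
      have fg: "disp ?f (anc t p (k - m) (r + m) g) \<in> simple_contact \<union> trivial_nodes"
        by (rule adjacent_anc) (use f(2) m in simp_all)
      have "disp (b (r + m)) ?f \<in> A \<union> trivial_nodes"
        by (rule Suc.IH) (use f(1) m in simp_all)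
      then show ?thesis
      proof
        assume "disp (b (r + m)) ?f \<in> A"
        then show ?thesis
          using disp_in_corona[of "b (r + m)" "anc t p (k - m) (r + m) g" ?f A] walk[OF m(1)] fg
            simple_contact_subset_contact_set
          unfolding a_def by blast
      next
        assume "disp (b (r + m)) ?f \<in> trivial_nodes"
        then have "a m \<in> simple_contact \<union> trivial_nodes"
          using fg by (simp add: a_def disp_trivial)
        then have "a m \<in> simple_contact"
          using walk[OF m(1)] by (auto simp: simple_ambient_nodes_def)
        then show ?thesis using A(2) subset_corona_nodes[OF A(1)] by blast
      qed
    qed
    ultimately have "a 0 \<in> sustained_core edge (corona_nodes A)"
      using k by (intro long_walk_in_core[OF A(3) N(2)]) simp_all
    then show ?thesis using A(4) by (auto simp: a_def)
  qed
qed

end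

end

text \<open>The edge equations say exactly that the faces \<open>b r\<close> and \<open>c r\<close>
  of the walk are the parents of those at the next level. Hence \<open>n\<close> is itself the
  pull-back of a pair at any later level \<open>k\<close>, where it can be joined by a
  chain.\<close>

lemma finite_core_subset_fixpoint:
  assumes A: "A \<subseteq> nodes" "simple_contact \<subseteq> A" "finite (corona_nodes A)"
    "sustained_core edge (corona_nodes A) \<subseteq> A"
  shows "finite_core edge nodes \<subseteq> A"
proof
  fix n assume "n \<in> finite_core edge nodes"
  then obtain S where S: "n \<in> S" "S \<subseteq> nodes" "finite S" "sustaining edge S"
    by (rule finite_coreE)
  obtain a where a: "a 0 = n" "\<And>r. a r \<in> S" "\<And>r. edge (a r) (a (Suc r))"
    using sustaining_walk[OF S(4,1)] by blast
  define i x j where "i r = fst (a r)" and "x r = mid (a r)" and "j r = snd (snd (a r))" for r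
  have ar: "a r = (i r, x r, j r)" for r by (simp add: i_def x_def j_def mid_def)
  have "\<exists>p q s u. \<sigma> (i (Suc r)) = p @ [i r] @ s \<and> \<sigma> (j (Suc r)) = q @ [j r] @ u \<and>
      incidence \<sigma> *v x (Suc r) = x r + abel q - abel p" for r
    using a(3)[of r] unfolding ar simple_rel_iff by blast
  then obtain p q s u where e: "\<And>r. \<sigma> (i (Suc r)) = p r @ [i r] @ s r"
      "\<And>r. \<sigma> (j (Suc r)) = q r @ [j r] @ u r"
      "\<And>r. incidence \<sigma> *v x (Suc r) = x r + abel (q r) - abel (p r)"
    by metis
  \<comment> \<open>The initial value is the least height at which both faces of the first pair lie
    on the surface, that is, the left end of the overlap of their intervals. The recursion solves
    \<open>level\<close> for the next height.\<close>
  define t where "t = rec_nat (max 0 (- (real_vec (x 0) \<bullet> v))) (\<lambda>r tr. (tr + word_length v (p r)) / \<beta>)"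
  have level: "t r = \<beta> * t (Suc r) - word_length v (p r)" for r
    using \<beta> by (simp add: t_def)
  have x_level: "\<beta> * (real_vec (x (Suc r)) \<bullet> v) = real_vec (x r) \<bullet> v + word_length v (q r) - word_length v (p r)" for r
    using arg_cong[OF e(3)[of r], of "\<lambda>y. real_vec y \<bullet> v"]
    by (simp add: eigen_inner real_vec_inner_simps abel_inner)
  define b c where "b r = (0 :: (int, 'n) vec, i r)" and "c r = (x r, j r)" for r
  have "b r \<in> surf (t r) \<and> c r \<in> surf (t r)" for r
  proof (induction r)
    case 0
    have "a 0 \<in> nodes" using a(2) S(2) by blast
    then show ?case
      by (auto simp: b_def c_def ar mem_surf real_vec_inner_simps mem_simple_ambient_nodes pos t_def max_def)
  next
    case (Suc r)
    have wl: "\<beta> * v $ i (Suc r) = word_length v (p r) + v $ i r + word_length v (s r)"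
      "\<beta> * v $ j (Suc r) = word_length v (q r) + v $ j r + word_length v (u r)"
      using e(1,2)[of r] word_length_image[of "i (Suc r)"] word_length_image[of "j (Suc r)"] by simp_all
    have nn: "0 \<le> word_length v (p r)" "0 \<le> word_length v (s r)" "0 \<le> word_length v (q r)" "0 \<le> word_length v (u r)"
      by (simp_all add: word_length_nonneg)
    \<comment> \<open>Scaled by \<open>\<beta>\<close>, each height falls into the tile of the old
      letter inside the image of the new one; the nonnegative prefix and suffix lengths leave room
      for the full interval.\<close>
    have "0 \<le> \<beta> * t (Suc r)" "\<beta> * t (Suc r) < \<beta> * v $ i (Suc r)"
      "0 \<le> \<beta> * (real_vec (x (Suc r)) \<bullet> v + t (Suc r))" "\<beta> * (real_vec (x (Suc r)) \<bullet> v + t (Suc r)) < \<beta> * v $ j (Suc r)"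
      using Suc.IH level[of r] x_level[of r] wl nn
      by (auto simp: b_def c_def mem_surf real_vec_inner_simps distrib_left)
    then show ?case
      using \<beta> by (simp add: b_def c_def mem_surf real_vec_inner_simps zero_le_mult_iff)
  qed
  then have surf: "\<And>r. b r \<in> surf (t r)" "\<And>r. c r \<in> surf (t r)" by simp_all
  have parents: "parent (t (Suc r)) (p r) (b (Suc r)) = b r" "parent (t (Suc r)) (p r) (c (Suc r)) = c r" for r
  proof -
    have s: "0 \<le> t r" "t r < v $ i r" "0 \<le> real_vec (x r) \<bullet> v + t r" "real_vec (x r) \<bullet> v + t r < v $ j r"
      using surf[of r] by (simp_all add: b_def c_def mem_surf real_vec_inner_simps)
    have "is_parent (t (Suc r)) (p r) (b (Suc r)) (b r)"
      unfolding is_parent_def b_def using e(1)[of r] s level[of r]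
      by (intro exI[of _ "p r"] exI[of _ "s r"]) (simp add: real_vec_inner_simps)
    then show "parent (t (Suc r)) (p r) (b (Suc r)) = b r" by (rule parent_eqI)
    have "is_parent (t (Suc r)) (p r) (c (Suc r)) (c r)"
      unfolding is_parent_def c_def using e(2,3)[of r] s level[of r] x_level[of r]
      by (intro exI[of _ "q r"] exI[of _ "u r"]) (simp add: distrib_left)
    then show "parent (t (Suc r)) (p r) (c (Suc r)) = c r" by (rule parent_eqI)
  qed
  define height where "height y = (\<Sum>l\<in>UNIV. nat \<bar>y $ l\<bar>)" for y :: "(int, 'n) vec"
  \<comment> \<open>The walk stays in the finite set \<open>S\<close>, so one \<open>L\<close>
    serves all levels. This removes the circularity between the level \<open>k\<close> and the
    length of the chain constructed there.\<close>
  obtain L where L: "\<And>r. height (x r) \<le> L"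
  proof
    fix r
    have "height (mid (a r)) \<le> Max ((\<lambda>n. height (mid n)) ` S)"
      using S(3) a(2) by (intro Max_ge) auto
    then show "height (x r) \<le> Max ((\<lambda>n. height (mid n)) ` S)" by (simp add: x_def)
  qed
  define N where "N = max (card pre_contact) (card (corona_nodes A))"
  \<comment> \<open>The chain has at most \<open>2 * L + 2\<close> steps, and a chain of
    \<open>l\<close> steps needs \<open>(l + 1) * N\<close> levels.\<close>
  define k where "k = (2 * L + 3) * N"
  obtain l where l: "l \<le> 2 * height (x k) + 2" "(adjacent (t k) ^^ l) (b k) (c k)"
    using surf_connected[OF surf(1)[of k, unfolded b_def] surf(2)[of k, unfolded c_def]]
    unfolding b_def c_def height_def by auto
  have "l + 1 \<le> 2 * L + 3" using l(1) L[of k] by linarith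
  then have "(l + 1) * N \<le> k" unfolding k_def by (rule mult_le_mono1)
  then have "disp (b 0) (anc t p k 0 (c k)) \<in> A \<union> trivial_nodes"
    using l(2) by (intro chain_anc[where t = t and p = p and b = b and A = A and N = N and r = 0 and l = l,
          OF level A _ _ surf(1) parents(1)]) (simp_all add: N_def)
  moreover have "anc t p k r (c (r + k)) = c r" for r
    by (induction k arbitrary: r) (simp_all add: parents(2) flip: add_Suc)
  from this[of 0] have "anc t p k 0 (c k) = c 0" by simp
  ultimately have "n \<in> A \<union> trivial_nodes"
    using a(1) by (simp add: disp_def b_def c_def ar)
  moreover have "n \<notin> trivial_nodes" using S(1,2) by (auto simp: simple_ambient_nodes_def)
  ultimately show "n \<in> A" by blast
qed


section \<open>The sequence of iterates\<close>

primrec contact_iterate :: "nat \<Rightarrow> 'n node set" where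
  "contact_iterate 0 = simple_contact"
| "contact_iterate (Suc r) = sustained_core edge (corona_nodes (contact_iterate r))"

lemma neighbor_iterate_eq:
  "neighbor_iterate \<sigma> v (Suc r) = edge_graph (contact_iterate r) (simple_ambient_edges \<sigma>)"
  by (induction r) (simp_all add: neighbor_iterate_def simple_contact_graph_eq corona_edge_graph Red_edge_graph)

lemma iterate_sustaining: "contact_iterate r \<subseteq> nodes" "sustaining edge (contact_iterate r)"
proof -
  show "contact_iterate r \<subseteq> nodes"
    using simple_contact_subset(2) sustaining_core(2)[of edge "corona_nodes A" for A] corona_nodes_subset
    by (cases r) (simp, simp, blast)
  show "sustaining edge (contact_iterate r)"
    by (cases r) (simp_all add: simple_contact_def sustaining_core(1))
qed

lemma finite_iterate: "finite (contact_iterate r)"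
proof (induction r)
  case 0
  then show ?case using simple_contact_subset(1) finite_pre_contact finite_subset by auto
next
  case (Suc r)
  then show ?case
    using finite_corona_nodes sustaining_core(2)[of edge "corona_nodes (contact_iterate r)"] finite_subset by auto
qed

lemma iterate_subset_finite_core: "contact_iterate r \<subseteq> finite_core edge nodes"
  by (intro finite_core_maximal iterate_sustaining finite_iterate)

text \<open>An iterate lies in its own corona through trivial displacements and is already
  self-sustaining, so it survives the next reduction.\<close>

lemma iterate_mono: "contact_iterate r \<subseteq> contact_iterate (Suc r)"
  using core_maximal[OF subset_corona_nodes iterate_sustaining(2)] iterate_sustaining(1) by simp

lemma contact_subset_iterate: "simple_contact \<subseteq> contact_iterate r"
  by (induction r) (use iterate_mono in auto)

lemma iterate_stabilizes: "\<exists>r. contact_iterate (Suc r) = contact_iterate r"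
proof (rule ccontr)
  assume "\<not> (\<exists>r. contact_iterate (Suc r) = contact_iterate r)"
  then have "card (contact_iterate r) < card (contact_iterate (Suc r))" for r
    using iterate_mono[of r] by (intro psubset_card_mono finite_iterate psubsetI) auto
  then have "r \<le> card (contact_iterate r)" for r
    by (induction r) (simp, metis Suc_leI le_less_trans)
  moreover have "card (contact_iterate r) \<le> card (finite_core edge nodes)" for r
    by (rule card_mono[OF finite_finite_core iterate_subset_finite_core])
  ultimately show False by (metis Suc_n_not_le_n le_trans)
qed

lemma iterate_fixpoint:
  assumes "contact_iterate (Suc r) = contact_iterate r"
  shows "contact_iterate r = finite_core edge nodes"
proof
  show "finite_core edge nodes \<subseteq> contact_iterate r"
    using assms by (intro finite_core_subset_fixpoint iterate_sustaining contact_subset_iterate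
        finite_corona_nodes finite_iterate) simp
qed (rule iterate_subset_finite_core)

lemma neighbor_iteration:
  shows "\<exists>p \<ge> 2. neighbor_iterate \<sigma> v p = neighbor_iterate \<sigma> v (p - 1) \<and>
    (\<forall>q. 2 \<le> q \<and> q < p \<longrightarrow> neighbor_iterate \<sigma> v q \<noteq> neighbor_iterate \<sigma> v (q - 1)) \<and>
    neighbor_iterate \<sigma> v p = simple_boundary_graph \<sigma> v \<and>
    boundary_graph \<sigma> v =
      ambient_graph \<sigma> v \<restriction> (verts (neighbor_iterate \<sigma> v p) \<inter> ambient_nodes v)"
proof -
  define r where "r = (LEAST r. contact_iterate (Suc r) = contact_iterate r)"
  have r: "contact_iterate (Suc r) = contact_iterate r"
    unfolding r_def by (rule LeastI_ex[OF iterate_stabilizes])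
  have fix_r: "contact_iterate r = finite_core edge nodes"
    by (rule iterate_fixpoint[OF r])
  have least: "contact_iterate (Suc r') \<noteq> contact_iterate r'" if "r' < r" for r'
    using that not_less_Least unfolding r_def by blast
  show ?thesis
  \<comment> \<open>\<open>contact_iterate r\<close> is the node set of A[r + 1], so the first
    equality of consecutive sets at \<open>r\<close> is detected by the algorithm at step r +
    2.\<close>
  proof (intro exI[of _ "Suc (Suc r)"] conjI allI impI)
    show "neighbor_iterate \<sigma> v (Suc (Suc r)) = neighbor_iterate \<sigma> v (Suc (Suc r) - 1)"
      using r by (simp only: neighbor_iterate_eq diff_Suc_1)
    show "neighbor_iterate \<sigma> v q \<noteq> neighbor_iterate \<sigma> v (q - 1)" if "2 \<le> q \<and> q < Suc (Suc r)" for q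
    proof -
      obtain r' where "q = Suc (Suc r')" "r' < r"
        using \<open>2 \<le> q \<and> q < Suc (Suc r)\<close> by (metis Suc_less_SucD Suc_le_D numeral_2_eq_2 Suc_le_mono)
      then show ?thesis
        using least by (simp only: neighbor_iterate_eq diff_Suc_1 edge_graph_eq_iff) simp
    qed
    show "neighbor_iterate \<sigma> v (Suc (Suc r)) = simple_boundary_graph \<sigma> v"
      unfolding neighbor_iterate_eq r fix_r simple_boundary_graph_def simple_ambient_graph_def
      by (rule loop_part_edge_graph[symmetric])
    show "boundary_graph \<sigma> v =
        ambient_graph \<sigma> v \<restriction> (verts (neighbor_iterate \<sigma> v (Suc (Suc r))) \<inter> ambient_nodes v)"
      unfolding neighbor_iterate_eq r fix_r boundary_graph_def ambient_graph_def loop_part_edge_graph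
        edge_graph_simps(1) finite_core_ambient[OF pos]
      by (rule edge_graph_induce[symmetric]) simp
  qed simp
qed

end

theorem theorem4p6:
  fixes v :: "real ^ 'n::{finite, linorder}" and \<sigma> :: "'n subst"
  assumes "CARD('n) \<ge> 2"
    and "pisot_substitution \<sigma>"
    and "dominant_left_eigenvector (incidence \<sigma>) v"
  shows "\<exists>p \<ge> 2. neighbor_iterate \<sigma> v p = neighbor_iterate \<sigma> v (p - 1) \<and>
    (\<forall>q. 2 \<le> q \<and> q < p \<longrightarrow> neighbor_iterate \<sigma> v q \<noteq> neighbor_iterate \<sigma> v (q - 1)) \<and>
    neighbor_iterate \<sigma> v p = simple_boundary_graph \<sigma> v \<and>
    boundary_graph \<sigma> v =
      ambient_graph \<sigma> v \<restriction> (verts (neighbor_iterate \<sigma> v p) \<inter> ambient_nodes v)"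
proof -
  have pos: "v $ i > 0" for i
    using assms(3) by (simp add: dominant_left_eigenvector_def)
  obtain \<beta> Z w where "pisot_setup \<sigma> v \<beta> Z w"
    by (rule pisot_coordinates[OF assms(2,3)]) (rule that, unfold_locales, auto intro: pos)
  then show ?thesis by (rule pisot_setup.neighbor_iteration)
qed

end
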